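(* Let $\mathcal{R}=(\mathcal{F},\Pi,\mu,E,H,R)$ be an EGTRS. (1) If $\mathcal{R}$ is $E$-terminating and every conditional pair in $\mathsf{LCCP}(\mathcal{R})\cup\mathsf{CVP}^{\to_{ps}}(\mathcal{R})\cup\mathsf{DCP}(\mathcal{R})\cup\mathsf{LCCP}(E,\mathcal{R})\cup\mathsf{CVP}^{\to_{ps}}(E)$ is joinable modulo $E$ with $\to_{\mathcal{R},E}$, then $\mathcal{R}$ is $E$-confluent. (2) If there is a pair in $\mathsf{LCCP}(\mathcal{R})\cup\mathsf{CVP}^{\to_{ps}}(\mathcal{R})\cup\mathsf{DCP}(\mathcal{R})$ which is not joinable modulo $E$ with $\to_{\mathcal{R}/E}$, then $\mathcal{R}$ is not $E$-confluent.
   Context: An EGTRS $\mathcal{R}=(\mathcal{F},\Pi,\mu,E,H,R)$ consists of a signature $\mathcal{F}$ of function symbols, a signature $\Pi$ of predicate symbols containing $=,\to,\to^*$, a replacement map $\mu$ (selecting the active, i.e. rewritable, argument positions of each function symbol), a set $E$ of conditional equations $s=t\Leftarrow c$, a set $H$ of definite Horn clauses $A\Leftarrow c$ whose head predicate is not $=,\to,\to^*$, and a set $R$ of conditional rules $\ell\to r\Leftarrow c$ with $\ell$ not a variable ($c$ always a sequence of atoms); the equality predicate is assumed not to depend on $R$. $R^{rm}$ is $R$ with conditions of the form $s\approx t$ reinterpreted via rewriting modulo $E$. The relations are: $s=_E t$ ($E$-equality); $s\to_{\mathcal{R}} t$ (written for $\to_{\mathcal{R}^{rm}}$) iff there are an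 active position $p$ of $s$, a rule $\ell\to r\Leftarrow c$ in $R^{rm}$ and a substitution $\sigma$ with $s|_p=\sigma(\ell)$, all atoms of $\sigma(c)$ deducible (conditions being evaluated using rewriting modulo), and $t=s[\sigma(r)]_p$; $s\to_{\mathcal{R},E}t$ (Peterson–Stickel rewriting, also denoted $\to_{ps}$) is defined the same way but with $s|_p=_E\sigma(\ell)$; $\to_{\mathcal{R}/E}={=_E}\circ\to_{\mathcal{R}}\circ{=_E}$. $\mathcal{R}$ is $E$-terminating iff $\to_{\mathcal{R}/E}$ is terminating; $\mathcal{R}$ is $E$-confluent iff whenever $t\to^*_{\mathcal{R}/E}t_1$ and $t\to^*_{\mathcal{R}/E}t_2$ there are $t_1',t_2'$ with $t_1\to^*_{\mathcal{R}/E}t_1'$, $t_2\to^*_{\mathcal{R}/E}t_2'$ and $t_1'=_E t_2'$. $\overleftrightarrow{E}$ denotes the (possibly variable-left-hand-side) rules $\lambda\to\rho\Leftarrow\gamma$ obtained by orienting each equation of $E$ both ways. A conditional pair $\langle s,t\rangle\Leftarrow c$ is feasible if some substitution satisfies all atoms of $c$; it is joinable modulo $E$ with a relation $\to$ if for every substitution $\sigma$ satisfying $c$ there are $u,u'$ with $\sigma(s)\to^*u$, $\sigma(t)\to^*u'$ and $u=_E u'$. $\mathsf{LCCP}(\mathcal{R})$: feasible pairs $\langle \ell[r']_p,r\rangle\Leftarrow \ell|_p=\ell',c,c'$ for variable-disjoint rules $\ell\to r\Leftarrow c$, $\ell'\to r'\Leftarrow c'$ in $R^{rm}$ and an active non-variable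 position $p$ of $\ell$. $\mathsf{LCCP}(E,\mathcal{R})$: feasible pairs $\langle \lambda[r]_p,\rho\rangle\Leftarrow \lambda|_p=\ell,\gamma,c$ for $\lambda\to\rho\Leftarrow\gamma$ in $\overleftrightarrow{E}$, $\ell\to r\Leftarrow c$ in $R^{rm}$ (variable-disjoint) and an active non-variable position $p$ of $\lambda$. $\mathsf{CVP}^{\to_{ps}}(\mathcal{R})$ (resp. $\mathsf{CVP}^{\to_{ps}}(E)$): feasible pairs $\langle \ell[x']_p,r\rangle\Leftarrow x\to_{ps}x',c$ for a rule $\ell\to r\Leftarrow c$ in $R^{rm}$ (resp. in $\overleftrightarrow{E}$), an active variable $x$ of $\ell$, an active position $p$ of $x$ in $\ell$ and a fresh variable $x'$. $\mathsf{DCP}(\mathcal{R})$: feasible pairs $\langle r,x'\rangle\Leftarrow x=\ell, x\to_{inner}x',c$ for a rule $\ell\to r\Leftarrow c$ in $R^{rm}$, with $x,x'$ fresh variables and $\to_{inner}$ a non-root $\to_{\mathcal{R}}$-step. *)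

theory Defs
  imports "HOL-Library.Countable" "HOL-Library.Infinite_Typeclass"
begin

datatype (fsyms: 'f, vars: 'v) trm = Var 'v | Fun 'f "('f, 'v) trm list"

type_synonym ('f, 'v) subst = "'v \<Rightarrow> ('f, 'v) trm"

fun subst :: "('f, 'v) subst \<Rightarrow> ('f, 'v) trm \<Rightarrow> ('f, 'v) trm" where
  "subst \<sigma> (Var x) = \<sigma> x"
| "subst \<sigma> (Fun f ts) = Fun f (map (subst \<sigma>) ts)"

lemma size_nth_trm [termination_simp]:
  "i < length ts \<Longrightarrow> size (ts ! i) < Suc (size_list size ts)"
  by (metis le_imp_less_Suc nth_mem order_refl size_list_estimation')

declare conj_cong [fundef_cong]

text \<open>Positions are lists of argument indices; indices start at 0.\<close>

fun active_poss :: "('f \<Rightarrow> nat set) \<Rightarrow> ('f, 'v) trm \<Rightarrow> nat list set" where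
  "active_poss \<mu> (Var x) = {[]}"
| "active_poss \<mu> (Fun f ts) =
     {[]} \<union> {i # p | i p. i < length ts \<and> i \<in> \<mu> f \<and> p \<in> active_poss \<mu> (ts ! i)}"

declare conj_cong [fundef_cong del]

fun subt_at :: "('f, 'v) trm \<Rightarrow> nat list \<Rightarrow> ('f, 'v) trm" where
  "subt_at t [] = t"
| "subt_at (Fun f ts) (i # p) = subt_at (ts ! i) p"
| "subt_at (Var x) (i # p) = Var x"

fun replace_at :: "('f, 'v) trm \<Rightarrow> nat list \<Rightarrow> ('f, 'v) trm \<Rightarrow> ('f, 'v) trm" where
  "replace_at t [] u = u"
| "replace_at (Fun f ts) (i # p) u = Fun f (ts[i := replace_at (ts ! i) p u])"
| "replace_at (Var x) (i # p) u = Var x"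

text \<open>
  The constructors \<open>Eq\<close>, \<open>Step\<close>, \<open>Steps\<close> are the predicates \<open>=\<close>, \<open>\<rightarrow>\<close>, \<open>\<rightarrow>\<^sup>*\<close>, present in every
  predicate signature; \<open>Approx s t\<close> is a condition \<open>s \<approx> t\<close>, which has no meaning until it is
  interpreted (see \<open>rm\<close> below).
\<close>

datatype (atom_fsyms: 'f, atom_psyms: 'p, atom_vars: 'v) atom =
    Eq "('f, 'v) trm" "('f, 'v) trm"
  | Step "('f, 'v) trm" "('f, 'v) trm"
  | Steps "('f, 'v) trm" "('f, 'v) trm"
  | Approx "('f, 'v) trm" "('f, 'v) trm"
  | Pred 'p "('f, 'v) trm list"

fun subst_atom :: "('f, 'v) subst \<Rightarrow> ('f, 'p, 'v) atom \<Rightarrow> ('f, 'p, 'v) atom" where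
  "subst_atom \<sigma> (Eq s t) = Eq (subst \<sigma> s) (subst \<sigma> t)"
| "subst_atom \<sigma> (Step s t) = Step (subst \<sigma> s) (subst \<sigma> t)"
| "subst_atom \<sigma> (Steps s t) = Steps (subst \<sigma> s) (subst \<sigma> t)"
| "subst_atom \<sigma> (Approx s t) = Approx (subst \<sigma> s) (subst \<sigma> t)"
| "subst_atom \<sigma> (Pred P ts) = Pred P (map (subst \<sigma>) ts)"

datatype 'p psym = PEq | PStep | PSteps | PApprox | PUser 'p

fun psym_of :: "('f, 'p, 'v) atom \<Rightarrow> 'p psym" where
  "psym_of (Eq s t) = PEq"
| "psym_of (Step s t) = PStep"
| "psym_of (Steps s t) = PSteps"
| "psym_of (Approx s t) = PApprox"
| "psym_of (Pred P ts) = PUser P"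

text \<open>A triple \<open>(l, r, c)\<close> is a conditional rule or equation with condition \<open>c\<close>.\<close>

type_synonym ('f, 'p, 'v) crule =
  "('f, 'v) trm \<times> ('f, 'v) trm \<times> ('f, 'p, 'v) atom list"

record ('f, 'p, 'v) egtrs =
  funs :: "'f set"
  arity :: "'f \<Rightarrow> nat"
  preds :: "'p set"
  parity :: "'p \<Rightarrow> nat"
  repl :: "'f \<Rightarrow> nat set"
  eqs :: "('f, 'p, 'v) crule set"
  horn :: "(('f, 'p, 'v) atom \<times> ('f, 'p, 'v) atom list) set"
  rules :: "('f, 'p, 'v) crule set"

fun wf_trm :: "('f, 'p, 'v) egtrs \<Rightarrow> ('f, 'v) trm \<Rightarrow> bool" where
  "wf_trm \<R> (Var x) \<longleftrightarrow> True"
| "wf_trm \<R> (Fun f ts) \<longleftrightarrow>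
     f \<in> funs \<R> \<and> length ts = arity \<R> f \<and> (\<forall>t \<in> set ts. wf_trm \<R> t)"

fun wf_atom :: "('f, 'p, 'v) egtrs \<Rightarrow> ('f, 'p, 'v) atom \<Rightarrow> bool" where
  "wf_atom \<R> (Eq s t) \<longleftrightarrow> wf_trm \<R> s \<and> wf_trm \<R> t"
| "wf_atom \<R> (Step s t) \<longleftrightarrow> wf_trm \<R> s \<and> wf_trm \<R> t"
| "wf_atom \<R> (Steps s t) \<longleftrightarrow> wf_trm \<R> s \<and> wf_trm \<R> t"
| "wf_atom \<R> (Approx s t) \<longleftrightarrow> wf_trm \<R> s \<and> wf_trm \<R> t"
| "wf_atom \<R> (Pred P ts) \<longleftrightarrow>
     P \<in> preds \<R> \<and> length ts = parity \<R> P \<and> (\<forall>t \<in> set ts. wf_trm \<R> t)"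

definition wf_subst :: "('f, 'p, 'v) egtrs \<Rightarrow> ('f, 'v) subst \<Rightarrow> bool" where
  "wf_subst \<R> \<sigma> \<longleftrightarrow> (\<forall>x. wf_trm \<R> (\<sigma> x))"

definition clauses ::
  "('f, 'p, 'v) egtrs \<Rightarrow> (('f, 'p, 'v) atom \<times> ('f, 'p, 'v) atom list) set" where
  "clauses \<R> = {(Eq s t, c) | s t c. (s, t, c) \<in> eqs \<R>} \<union> horn \<R> \<union>
     {(Step l r, c) | l r c. (l, r, c) \<in> rules \<R>}"

definition psym_dep :: "('f, 'p, 'v) egtrs \<Rightarrow> ('p psym \<times> 'p psym) set" where
  "psym_dep \<R> = {(psym_of A, psym_of B) | A B c. (A, c) \<in> clauses \<R> \<and> B \<in> set c}"

definition is_egtrs :: "('f, 'p, 'v) egtrs \<Rightarrow> bool" where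
  "is_egtrs \<R> \<longleftrightarrow>
     (\<forall>f \<in> funs \<R>. repl \<R> f \<subseteq> {..<arity \<R> f}) \<and>
     (\<forall>(A, c) \<in> clauses \<R>. wf_atom \<R> A \<and> (\<forall>B \<in> set c. wf_atom \<R> B)) \<and>
     (\<forall>(A, c) \<in> horn \<R>. \<exists>P. psym_of A = PUser P) \<and>
     (\<forall>(l, r, c) \<in> rules \<R>. \<nexists>x. l = Var x) \<and>
     (\<forall>Q \<in> {PStep, PSteps, PApprox}. (PEq, Q) \<notin> (psym_dep \<R>)\<^sup>+)"

text \<open>
  In \<open>rm \<R>\<close> a condition \<open>s \<approx> t\<close> becomes \<open>s \<rightarrow>\<^sup>* t\<close>, and \<open>ded\<close> below evaluates \<open>\<rightarrow>\<close> and \<open>\<rightarrow>\<^sup>*\<close>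
  by rewriting modulo. Conditions \<open>s \<approx> t\<close> in equations are excluded by \<open>is_egtrs\<close>.
\<close>

fun rm_atom :: "('f, 'p, 'v) atom \<Rightarrow> ('f, 'p, 'v) atom" where
  "rm_atom (Approx s t) = Steps s t"
| "rm_atom A = A"

definition rm :: "('f, 'p, 'v) egtrs \<Rightarrow> ('f, 'p, 'v) egtrs" where
  "rm \<R> = \<R>\<lparr>horn := {(A, map rm_atom c) | A c. (A, c) \<in> horn \<R>},
            rules := {(l, r, map rm_atom c) | l r c. (l, r, c) \<in> rules \<R>}\<rparr>"

text \<open>
  Deducibility of atoms. Equality is a congruence in all arguments, active or not. A deducible
  \<open>Step s t\<close> is a step of rewriting modulo, so that this is what rule conditions refer to.
\<close>

inductive ded :: "('f, 'p, 'v) egtrs \<Rightarrow> ('f, 'p, 'v) atom \<Rightarrow> bool" for \<R> where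
  eq_refl: "wf_trm \<R> t \<Longrightarrow> ded \<R> (Eq t t)"
| eq_sym: "ded \<R> (Eq s t) \<Longrightarrow> ded \<R> (Eq t s)"
| eq_trans: "ded \<R> (Eq s t) \<Longrightarrow> ded \<R> (Eq t u) \<Longrightarrow> ded \<R> (Eq s u)"
| eq_cong: "wf_trm \<R> (Fun f ts) \<Longrightarrow> i < length ts \<Longrightarrow> ded \<R> (Eq (ts ! i) u) \<Longrightarrow>
    ded \<R> (Eq (Fun f ts) (Fun f (ts[i := u])))"
| eq_clause: "(s, t, c) \<in> eqs \<R> \<Longrightarrow> wf_subst \<R> \<sigma> \<Longrightarrow>
    (\<And>A. A \<in> set c \<Longrightarrow> ded \<R> (subst_atom \<sigma> A)) \<Longrightarrow> ded \<R> (Eq (subst \<sigma> s) (subst \<sigma> t))"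
| horn_clause: "(B, c) \<in> horn \<R> \<Longrightarrow> wf_subst \<R> \<sigma> \<Longrightarrow>
    (\<And>A. A \<in> set c \<Longrightarrow> ded \<R> (subst_atom \<sigma> A)) \<Longrightarrow> ded \<R> (subst_atom \<sigma> B)"
| step: "ded \<R> (Eq s u) \<Longrightarrow> p \<in> active_poss (repl \<R>) u \<Longrightarrow>
    (l, r, c) \<in> rules \<R> \<Longrightarrow> wf_subst \<R> \<sigma> \<Longrightarrow> subt_at u p = subst \<sigma> l \<Longrightarrow>
    (\<And>A. A \<in> set c \<Longrightarrow> ded \<R> (subst_atom \<sigma> A)) \<Longrightarrow>
    ded \<R> (Eq (replace_at u p (subst \<sigma> r)) t) \<Longrightarrow> ded \<R> (Step s t)"
| steps_refl: "wf_trm \<R> t \<Longrightarrow> ded \<R> (Steps t t)"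
| steps_step: "ded \<R> (Step s t) \<Longrightarrow> ded \<R> (Steps t u) \<Longrightarrow> ded \<R> (Steps s u)"

definition E_eq :: "('f, 'p, 'v) egtrs \<Rightarrow> ('f, 'v) trm \<Rightarrow> ('f, 'v) trm \<Rightarrow> bool" where
  "E_eq \<R> s t \<longleftrightarrow> ded (rm \<R>) (Eq s t)"

definition rew_at ::
  "('f, 'p, 'v) egtrs \<Rightarrow> nat list \<Rightarrow> ('f, 'v) trm \<Rightarrow> ('f, 'v) trm \<Rightarrow> bool" where
  "rew_at \<R> p s t \<longleftrightarrow> wf_trm \<R> s \<and> p \<in> active_poss (repl \<R>) s \<and>
     (\<exists>l r c \<sigma>. (l, r, c) \<in> rules (rm \<R>) \<and> wf_subst \<R> \<sigma> \<and> subt_at s p = subst \<sigma> l \<and>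
        (\<forall>A \<in> set c. ded (rm \<R>) (subst_atom \<sigma> A)) \<and> t = replace_at s p (subst \<sigma> r))"

definition rew :: "('f, 'p, 'v) egtrs \<Rightarrow> ('f, 'v) trm \<Rightarrow> ('f, 'v) trm \<Rightarrow> bool" where
  "rew \<R> s t \<longleftrightarrow> (\<exists>p. rew_at \<R> p s t)"

definition inner_rew :: "('f, 'p, 'v) egtrs \<Rightarrow> ('f, 'v) trm \<Rightarrow> ('f, 'v) trm \<Rightarrow> bool" where
  "inner_rew \<R> s t \<longleftrightarrow> (\<exists>p. p \<noteq> [] \<and> rew_at \<R> p s t)"

definition ps_rew :: "('f, 'p, 'v) egtrs \<Rightarrow> ('f, 'v) trm \<Rightarrow> ('f, 'v) trm \<Rightarrow> bool" where
  "ps_rew \<R> s t \<longleftrightarrow> wf_trm \<R> s \<and> (\<exists>p \<in> active_poss (repl \<R>) s.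
     \<exists>l r c \<sigma>. (l, r, c) \<in> rules (rm \<R>) \<and> wf_subst \<R> \<sigma> \<and> E_eq \<R> (subt_at s p) (subst \<sigma> l) \<and>
        (\<forall>A \<in> set c. ded (rm \<R>) (subst_atom \<sigma> A)) \<and> t = replace_at s p (subst \<sigma> r))"

definition mod_rew :: "('f, 'p, 'v) egtrs \<Rightarrow> ('f, 'v) trm \<Rightarrow> ('f, 'v) trm \<Rightarrow> bool" where
  "mod_rew \<R> = E_eq \<R> OO rew \<R> OO E_eq \<R>"

definition E_terminating :: "('f, 'p, 'v) egtrs \<Rightarrow> bool" where
  "E_terminating \<R> \<longleftrightarrow> (\<nexists>s. \<forall>i::nat. mod_rew \<R> (s i) (s (Suc i)))"

definition E_confluent :: "('f, 'p, 'v) egtrs \<Rightarrow> bool" where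
  "E_confluent \<R> \<longleftrightarrow> (\<forall>t t1 t2. wf_trm \<R> t \<and> (mod_rew \<R>)\<^sup>*\<^sup>* t t1 \<and> (mod_rew \<R>)\<^sup>*\<^sup>* t t2 \<longrightarrow>
     (\<exists>t1' t2'. (mod_rew \<R>)\<^sup>*\<^sup>* t1 t1' \<and> (mod_rew \<R>)\<^sup>*\<^sup>* t2 t2' \<and> E_eq \<R> t1' t2'))"

text \<open>
  Conditions of conditional pairs may also contain the predicates \<open>\<rightarrow>\<^sub>p\<^sub>s\<close> and \<open>\<rightarrow>\<^sub>i\<^sub>n\<^sub>n\<^sub>e\<^sub>r\<close>, which are
  not available in the clauses of an EGTRS.
\<close>

datatype ('f, 'p, 'v) patom =
    Base "('f, 'p, 'v) atom"
  | PSStep "('f, 'v) trm" "('f, 'v) trm"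
  | InnerStep "('f, 'v) trm" "('f, 'v) trm"

type_synonym ('f, 'p, 'v) cpair =
  "('f, 'v) trm \<times> ('f, 'v) trm \<times> ('f, 'p, 'v) patom list"

fun sat_patom :: "('f, 'p, 'v) egtrs \<Rightarrow> ('f, 'v) subst \<Rightarrow> ('f, 'p, 'v) patom \<Rightarrow> bool" where
  "sat_patom \<R> \<sigma> (Base A) \<longleftrightarrow> ded (rm \<R>) (subst_atom \<sigma> A)"
| "sat_patom \<R> \<sigma> (PSStep s t) \<longleftrightarrow> ps_rew \<R> (subst \<sigma> s) (subst \<sigma> t)"
| "sat_patom \<R> \<sigma> (InnerStep s t) \<longleftrightarrow> inner_rew \<R> (subst \<sigma> s) (subst \<sigma> t)"

definition satisfies ::
  "('f, 'p, 'v) egtrs \<Rightarrow> ('f, 'v) subst \<Rightarrow> ('f, 'p, 'v) patom list \<Rightarrow> bool" where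
  "satisfies \<R> \<sigma> c \<longleftrightarrow> wf_subst \<R> \<sigma> \<and> (\<forall>A \<in> set c. sat_patom \<R> \<sigma> A)"

definition feasible :: "('f, 'p, 'v) egtrs \<Rightarrow> ('f, 'p, 'v) cpair \<Rightarrow> bool" where
  "feasible \<R> = (\<lambda>(s, t, c). \<exists>\<sigma>. satisfies \<R> \<sigma> c)"

definition joinable_mod ::
  "('f, 'p, 'v) egtrs \<Rightarrow> (('f, 'v) trm \<Rightarrow> ('f, 'v) trm \<Rightarrow> bool) \<Rightarrow> ('f, 'p, 'v) cpair \<Rightarrow> bool" where
  "joinable_mod \<R> rel = (\<lambda>(s, t, c). \<forall>\<sigma>. satisfies \<R> \<sigma> c \<longrightarrow>
     (\<exists>u u'. rel\<^sup>*\<^sup>* (subst \<sigma> s) u \<and> rel\<^sup>*\<^sup>* (subst \<sigma> t) u' \<and> E_eq \<R> u u'))"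

definition rule_vars :: "('f, 'p, 'v) crule \<Rightarrow> 'v set" where
  "rule_vars = (\<lambda>(l, r, c). vars l \<union> vars r \<union> (\<Union>A \<in> set c. atom_vars A))"

definition rename_rule :: "('v \<Rightarrow> 'v) \<Rightarrow> ('f, 'p, 'v) crule \<Rightarrow> ('f, 'p, 'v) crule" where
  "rename_rule \<pi> = (\<lambda>(l, r, c).
     (subst (Var \<circ> \<pi>) l, subst (Var \<circ> \<pi>) r, map (subst_atom (Var \<circ> \<pi>)) c))"

definition variants :: "('f, 'p, 'v) crule set \<Rightarrow> ('f, 'p, 'v) crule set" where
  "variants S = {rename_rule \<pi> \<alpha> | \<pi> \<alpha>. bij \<pi> \<and> \<alpha> \<in> S}"

definition oriented_eqs :: "('f, 'p, 'v) egtrs \<Rightarrow> ('f, 'p, 'v) crule set" where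
  "oriented_eqs \<R> = eqs \<R> \<union> {(t, s, c) | s t c. (s, t, c) \<in> eqs \<R>}"

text \<open>
  Logic-based conditional critical pairs from rules of \<open>S\<close> (outer rule) and \<open>S'\<close> (inner rule);
  the inner rule is renamed apart.
\<close>

definition LCCPs ::
  "('f, 'p, 'v) egtrs \<Rightarrow> ('f, 'p, 'v) crule set \<Rightarrow> ('f, 'p, 'v) crule set \<Rightarrow>
   ('f, 'p, 'v) cpair set" where
  "LCCPs \<R> S S' = {\<pi>. feasible \<R> \<pi> \<and> (\<exists>l r c l' r' c' p.
     (l, r, c) \<in> S \<and> (l', r', c') \<in> variants S' \<and>
     rule_vars (l, r, c) \<inter> rule_vars (l', r', c') = {} \<and>
     p \<in> active_poss (repl \<R>) l \<and> (\<nexists>x. subt_at l p = Var x) \<and>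
     \<pi> = (replace_at l p r', r, Base (Eq (subt_at l p) l') # map Base c @ map Base c'))}"

definition CVPs ::
  "('f, 'p, 'v) egtrs \<Rightarrow> ('f, 'p, 'v) crule set \<Rightarrow> ('f, 'p, 'v) cpair set" where
  "CVPs \<R> S = {\<pi>. feasible \<R> \<pi> \<and> (\<exists>l r c p x x'.
     (l, r, c) \<in> S \<and> p \<in> active_poss (repl \<R>) l \<and> subt_at l p = Var x \<and>
     x' \<notin> rule_vars (l, r, c) \<and>
     \<pi> = (replace_at l p (Var x'), r, PSStep (Var x) (Var x') # map Base c))}"

definition LCCP :: "('f, 'p, 'v) egtrs \<Rightarrow> ('f, 'p, 'v) cpair set" where
  "LCCP \<R> = LCCPs \<R> (rules (rm \<R>)) (rules (rm \<R>))"

definition LCCP_E :: "('f, 'p, 'v) egtrs \<Rightarrow> ('f, 'p, 'v) cpair set" where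
  "LCCP_E \<R> = LCCPs \<R> (oriented_eqs \<R>) (rules (rm \<R>))"

definition CVP_ps :: "('f, 'p, 'v) egtrs \<Rightarrow> ('f, 'p, 'v) cpair set" where
  "CVP_ps \<R> = CVPs \<R> (rules (rm \<R>))"

definition CVP_ps_E :: "('f, 'p, 'v) egtrs \<Rightarrow> ('f, 'p, 'v) cpair set" where
  "CVP_ps_E \<R> = CVPs \<R> (oriented_eqs \<R>)"

definition DCP :: "('f, 'p, 'v) egtrs \<Rightarrow> ('f, 'p, 'v) cpair set" where
  "DCP \<R> = {\<pi>. feasible \<R> \<pi> \<and> (\<exists>l r c x x'.
     (l, r, c) \<in> rules (rm \<R>) \<and> x \<noteq> x' \<and> x \<notin> rule_vars (l, r, c) \<and> x' \<notin> rule_vars (l, r, c) \<and>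
     \<pi> = (r, Var x', Base (Eq (Var x) l) # InnerStep (Var x) (Var x') # map Base c))}"

text \<open>
  Rewriting steps in conditions mean rewriting modulo, and since equality does not depend on the
  rules, \<open>E_eq\<close> is deducibility from the equations and Horn clauses alone.
\<close>

lemma sig_rm [simp]: "funs (rm \<R>) = funs \<R>" "arity (rm \<R>) = arity \<R>" "eqs (rm \<R>) = eqs \<R>"
  by (simp_all add: rm_def)

lemma wf_trm_rm [simp]: "wf_trm (rm \<R>) t = wf_trm \<R> t"
  by (induction t) auto

lemma wf_subst_rm [simp]: "wf_subst (rm \<R>) \<sigma> = wf_subst \<R> \<sigma>"
  by (simp add: wf_subst_def)

lemma repl_rm [simp]: "repl (rm \<R>) = repl \<R>"
  by (simp add: rm_def)

lemma wf_trm_subst: "wf_subst \<R> \<sigma> \<Longrightarrow> wf_trm \<R> t \<Longrightarrow> wf_trm \<R> (subst \<sigma> t)"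
  by (induction t) (auto simp: wf_subst_def)

lemma is_egtrs_eqs_wf:
  assumes "is_egtrs \<R>" "(s, t, c) \<in> eqs \<R>" shows "wf_trm \<R> s" "wf_trm \<R> t"
proof -
  have "(Eq s t, c) \<in> clauses \<R>" using assms(2) by (simp add: clauses_def)
  moreover have "\<forall>(A, c) \<in> clauses \<R>. wf_atom \<R> A \<and> (\<forall>B \<in> set c. wf_atom \<R> B)"
    using assms(1) by (simp add: is_egtrs_def)
  ultimately have "wf_atom \<R> (Eq s t)" by blast
  then show "wf_trm \<R> s" "wf_trm \<R> t" by simp_all
qed

lemma horn_rmE:
  assumes "(B, c) \<in> horn (rm \<R>)"
  obtains c0 where "(B, c0) \<in> horn \<R>" "c = map rm_atom c0"
  using assms by (auto simp: rm_def)

lemma is_egtrs_horn_head: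
  assumes "is_egtrs \<R>" "(B, c) \<in> horn (rm \<R>)" shows "\<exists>P ts. B = Pred P ts"
proof -
  obtain c0 where "(B, c0) \<in> horn \<R>" using assms(2) by (rule horn_rmE)
  moreover have "\<forall>(A, c) \<in> horn \<R>. \<exists>P. psym_of A = PUser P"
    using assms(1) by (simp add: is_egtrs_def)
  ultimately have "\<exists>P. psym_of B = PUser P" by blast
  then show ?thesis by (cases B) auto
qed

lemma ded_Eq_wf:
  assumes "is_egtrs \<R>" "ded (rm \<R>) A"
  shows "A = Eq s t \<Longrightarrow> wf_trm \<R> s \<and> wf_trm \<R> t"
  using assms(2)
proof (induction arbitrary: s t rule: ded.induct)
  case (eq_cong f ts i u)
  then have "wf_trm \<R> u" by blast
  then have "\<forall>t \<in> set (ts[i := u]). wf_trm \<R> t"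
    using eq_cong(1) set_update_subset_insert[of ts i u] by auto
  then show ?case using eq_cong(1) eq_cong.prems by auto
next
  case (eq_clause s t c \<sigma>)
  then show ?case using is_egtrs_eqs_wf[OF assms(1)] by (auto simp: wf_trm_subst)
next
  case (horn_clause B c \<sigma>)
  then obtain P ts where "B = Pred P ts"
    using is_egtrs_horn_head[OF assms(1)] by blast
  then show ?case using horn_clause.prems by simp
qed auto

lemma ded_Step_iff:
  assumes "is_egtrs \<R>"
  shows "ded (rm \<R>) (Step s t) \<longleftrightarrow> mod_rew \<R> s t"
proof
  assume "ded (rm \<R>) (Step s t)"
  then show "mod_rew \<R> s t"
  proof cases
    case (horn_clause B c \<sigma>)
    then obtain P ts where "B = Pred P ts"
      using is_egtrs_horn_head[OF assms] by blast
    then show ?thesis using horn_clause by simp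
  next
    case (step u p l r c \<sigma>)
    then have "rew \<R> u (replace_at u p (subst \<sigma> r))"
      using ded_Eq_wf[OF assms step(1) refl] unfolding rew_def rew_at_def
      by (intro exI[of _ p] conjI exI[of _ l] exI[of _ r] exI[of _ c] exI[of _ \<sigma>]) auto
    then show ?thesis using step unfolding mod_rew_def E_eq_def by blast
  qed
next
  assume "mod_rew \<R> s t"
  then show "ded (rm \<R>) (Step s t)"
    unfolding mod_rew_def E_eq_def rew_def rew_at_def by (auto intro: ded.step)
qed

lemma ded_Steps_iff:
  assumes "is_egtrs \<R>" "wf_trm \<R> s"
  shows "ded (rm \<R>) (Steps s t) \<longleftrightarrow> (mod_rew \<R>)\<^sup>*\<^sup>* s t"
proof
  have "A = Steps s t \<Longrightarrow> (mod_rew \<R>)\<^sup>*\<^sup>* s t" if "ded (rm \<R>) A" for A s t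
    using that
  proof (induction arbitrary: s t rule: ded.induct)
    case (horn_clause B c \<sigma>)
    then obtain P ts where "B = Pred P ts"
      using is_egtrs_horn_head[OF assms(1)] by blast
    then show ?case using horn_clause.prems by simp
  next
    case (steps_step s t u)
    then show ?case using ded_Step_iff[OF assms(1)]
      by (auto intro: converse_rtranclp_into_rtranclp)
  qed auto
  then show "ded (rm \<R>) (Steps s t) \<Longrightarrow> (mod_rew \<R>)\<^sup>*\<^sup>* s t" by blast
next
  assume "(mod_rew \<R>)\<^sup>*\<^sup>* s t"
  then show "ded (rm \<R>) (Steps s t)" using assms(2)
  proof (induction rule: converse_rtranclp_induct)
    case base
    then show ?case by (simp add: ded.steps_refl)
  next
    case (step s u)
    have "wf_trm \<R> u"
      using step(1) ded_Eq_wf[OF assms(1)] unfolding mod_rew_def E_eq_def by blast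
    with step show ?case using ded_Step_iff[OF assms(1)] by (auto intro: ded.steps_step)
  qed
qed

lemma psym_of_subst_atom [simp]: "psym_of (subst_atom \<sigma> A) = psym_of A"
  by (cases A) auto

lemma wf_trm_rules_update [simp]: "wf_trm (\<R>\<lparr>rules := S\<rparr>) t = wf_trm \<R> t"
  by (induction t) auto

lemma wf_subst_rules_update [simp]: "wf_subst (\<R>\<lparr>rules := S\<rparr>) \<sigma> = wf_subst \<R> \<sigma>"
  by (simp add: wf_subst_def)

lemma E_eq_iff_ded_without_rules:
  assumes "is_egtrs \<R>"
  shows "E_eq \<R> s t \<longleftrightarrow> ded (\<R>\<lparr>rules := {}\<rparr>) (Eq s t)"
proof
  let ?D = "{Q. (PEq, Q) \<in> (psym_dep \<R>)\<^sup>*}"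
  have no: "PStep \<notin> ?D" "PSteps \<notin> ?D" "PApprox \<notin> ?D"
    using assms unfolding is_egtrs_def by (auto simp: rtrancl_eq_or_trancl)
  have cl: "psym_of B \<in> ?D" if "(A, c) \<in> clauses \<R>" "psym_of A \<in> ?D" "B \<in> set c" for A B c
    using that unfolding psym_dep_def by (auto intro: rtrancl_into_rtrancl)
  have rm_id: "rm_atom B = B" if "psym_of B \<in> ?D" for B :: "('a, 'b, 'c) atom"
    using that no(3) by (cases B) auto
  have "psym_of A \<in> ?D \<Longrightarrow> ded (\<R>\<lparr>rules := {}\<rparr>) A" if "ded (rm \<R>) A" for A
    using that
  proof (induction rule: ded.induct)
    case (eq_clause s t c \<sigma>)
    have *: "(s, t, c) \<in> eqs \<R>" using eq_clause by simp
    have "(Eq s t, c) \<in> clauses \<R>" using * by (auto simp: clauses_def)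
    from cl[OF this] eq_clause * show ?case
      by (intro ded.eq_clause[of _ _ c]) simp_all
  next
    case (horn_clause B c \<sigma>)
    obtain c0 where *: "(B, c0) \<in> horn \<R>" "c = map rm_atom c0"
      using horn_clause(1) by (rule horn_rmE)
    have "(B, c0) \<in> clauses \<R>" using * by (auto simp: clauses_def)
    from cl[OF this] horn_clause.prems have D: "\<And>A. A \<in> set c0 \<Longrightarrow> psym_of A \<in> ?D" by auto
    then have [simp]: "c = c0" using rm_id *(2) by (metis map_idI)
    show ?case
    proof (rule ded.horn_clause)
      show "(B, c0) \<in> horn (\<R>\<lparr>rules := {}\<rparr>)" using * by simp
      show "wf_subst (\<R>\<lparr>rules := {}\<rparr>) \<sigma>" using horn_clause(2) by simp
      show "ded (\<R>\<lparr>rules := {}\<rparr>) (subst_atom \<sigma> A)" if "A \<in> set c0" for A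
        using horn_clause.IH[of A] D[OF that] that by simp
    qed
  next
    case (eq_sym s t)
    then show ?case by (auto intro: ded.eq_sym)
  next
    case (eq_trans s t u)
    then show ?case by (auto intro: ded.eq_trans)
  next
    case (eq_cong f ts i u)
    then show ?case by (intro ded.eq_cong) auto
  qed (use no in \<open>auto intro: ded.eq_refl\<close>)
  then show "E_eq \<R> s t \<Longrightarrow> ded (\<R>\<lparr>rules := {}\<rparr>) (Eq s t)" by (simp add: E_eq_def)
next
  let ?D = "{Q. (PEq, Q) \<in> (psym_dep \<R>)\<^sup>*}"
  have no: "PStep \<notin> ?D" "PSteps \<notin> ?D" "PApprox \<notin> ?D"
    using assms unfolding is_egtrs_def by (auto simp: rtrancl_eq_or_trancl)
  have cl: "psym_of B \<in> ?D" if "(A, c) \<in> clauses \<R>" "psym_of A \<in> ?D" "B \<in> set c" for A B c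
    using that unfolding psym_dep_def by (auto intro: rtrancl_into_rtrancl)
  have rm_id: "rm_atom B = B" if "psym_of B \<in> ?D" for B :: "('a, 'b, 'c) atom"
    using that no(3) by (cases B) auto
  have "psym_of A \<in> ?D \<Longrightarrow> ded (rm \<R>) A" if "ded (\<R>\<lparr>rules := {}\<rparr>) A" for A
    using that
  proof (induction rule: ded.induct)
    case (eq_clause s t c \<sigma>)
    have *: "(s, t, c) \<in> eqs \<R>" using eq_clause by simp
    have "(Eq s t, c) \<in> clauses \<R>" using * by (auto simp: clauses_def)
    from cl[OF this] eq_clause * show ?case
      by (intro ded.eq_clause[of _ _ c]) simp_all
  next
    case (horn_clause B c \<sigma>)
    then have *: "(B, c) \<in> clauses \<R>" by (auto simp: clauses_def)
    from cl[OF this] horn_clause.prems have D: "\<And>A. A \<in> set c \<Longrightarrow> psym_of A \<in> ?D" by auto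
    then have id: "map rm_atom c = c" using rm_id by (metis map_idI)
    show ?case
    proof (rule ded.horn_clause)
      have "(B, map rm_atom c) \<in> horn (rm \<R>)" using horn_clause(1) by (auto simp: rm_def)
      then show "(B, c) \<in> horn (rm \<R>)" by (simp only: id)
      show "wf_subst (rm \<R>) \<sigma>" using horn_clause(2) by simp
      show "ded (rm \<R>) (subst_atom \<sigma> A)" if "A \<in> set c" for A
        using horn_clause.IH[of A] D[OF that] that by simp
    qed
  next
    case (eq_sym s t)
    then show ?case by (auto intro: ded.eq_sym)
  next
    case (eq_trans s t u)
    then show ?case by (auto intro: ded.eq_trans)
  next
    case (eq_cong f ts i u)
    then show ?case by (intro ded.eq_cong) auto
  qed (use no in \<open>auto intro: ded.eq_refl\<close>)
  then show "ded (\<R>\<lparr>rules := {}\<rparr>) (Eq s t) \<Longrightarrow> E_eq \<R> s t" by (simp add: E_eq_def)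
qed

end

theory Submission
  imports Defs
begin

text \<open>
  The argument follows Jouannaud and Kirchner. A peak of a Peterson--Stickel step and a rewrite
  step is either disjoint, or an overlap at a non-variable position of the upper left-hand side
  (LCCP), or lies below one of its variables (CVP), or has the rewrite step strictly inside the
  Peterson--Stickel redex (DCP). A peak of a Peterson--Stickel step and a single use of an equation
  is classified in the same way, except that an equation applied inside the redex is absorbed by
  matching modulo \<open>E\<close>; only equations above the redex give pairs, and their position is then active.
  Hence all these local peaks are joinable. Well-founded induction along rewriting modulo then shows
  that any two Peterson--Stickel normal forms reachable from one term are \<open>E\<close>-equal.
  Conversely, each instance of a pair that satisfies its condition comes from a peak of rewriting
  modulo, so confluence makes it joinable.
\<close>

section \<open>Abstract rewriting modulo a symmetric relation\<close>

text \<open>Roles: \<open>H\<close> is a single use of an equation, \<open>R\<close> plain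
  rewriting, \<open>P\<close> Peterson-Stickel rewriting. Joinability is assumed only for local
  peaks, \<open>P\<close> against one \<open>R\<close> step or one \<open>H\<close> step;
  termination modulo \<open>H\<close> extends it to whole chains.\<close>

locale rewriting_modulo =
  fixes H R P :: "'a \<Rightarrow> 'a \<Rightarrow> bool"
  assumes symp_H: "symp H"
    and R_P: "R a b \<Longrightarrow> P a b"
    and P_mod: "P a b \<Longrightarrow> (H\<^sup>*\<^sup>* OO R OO H\<^sup>*\<^sup>*) a b"
    and wfp_mod: "wfp (H\<^sup>*\<^sup>* OO R OO H\<^sup>*\<^sup>*)\<inverse>\<inverse>"
    and local_confluence:
      "P a b \<Longrightarrow> R a c \<Longrightarrow> \<exists>u v. P\<^sup>*\<^sup>* b u \<and> P\<^sup>*\<^sup>* c v \<and> H\<^sup>*\<^sup>* u v"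
    and local_coherence:
      "P a b \<Longrightarrow> H a c \<Longrightarrow> \<exists>u v. P\<^sup>*\<^sup>* b u \<and> P\<^sup>*\<^sup>* c v \<and> H\<^sup>*\<^sup>* u v"
begin

abbreviation M where "M \<equiv> H\<^sup>*\<^sup>* OO R OO H\<^sup>*\<^sup>*"

abbreviation reach where "reach \<equiv> (sup P H)\<^sup>*\<^sup>*"

definition nf where "nf n \<longleftrightarrow> (\<nexists>m. P n m)"

section \<open>Absorption of equality steps and cycles\<close>

lemma H_rtranclp_sym: "H\<^sup>*\<^sup>* a b \<Longrightarrow> H\<^sup>*\<^sup>* b a"
  by (metis symp_H sympD symp_rtranclp)

lemma H_M: "H\<^sup>*\<^sup>* a b \<Longrightarrow> M b c \<Longrightarrow> M a c"
  by (auto intro: rtranclp_trans)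

lemma M_H: "M a b \<Longrightarrow> H\<^sup>*\<^sup>* b c \<Longrightarrow> M a c"
  by (auto intro: rtranclp_trans)

lemma P_reach: "P\<^sup>*\<^sup>* a b \<Longrightarrow> reach a b"
  by (metis (no_types) rtranclp_mono sup_ge1 predicate2D)

lemma H_reach: "H\<^sup>*\<^sup>* a b \<Longrightarrow> reach a b"
  by (metis (no_types) rtranclp_mono sup_ge2 predicate2D)

lemma ex_nf: "\<exists>n. P\<^sup>*\<^sup>* a n \<and> nf n"
proof (induction a rule: wfp_induct_rule[OF wfp_mod])
  case (1 a)
  show ?case
  proof (cases "nf a")
    case False
    then obtain b where "P a b" by (auto simp: nf_def)
    with 1 P_mod show ?thesis by (meson conversepI converse_rtranclp_into_rtranclp)
  qed auto
qed

text \<open>Leading \<open>H\<close> steps are absorbed into the first \<open>M\<close> step, if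
  there is one.\<close>

lemma reach_cases: "reach a b \<Longrightarrow> H\<^sup>*\<^sup>* a b \<or> (\<exists>a'. M a a' \<and> reach a' b)"
proof (induction rule: converse_rtranclp_induct)
  case (step a a1)
  show ?case
  proof (cases "P a a1")
    case True
    then show ?thesis using P_mod step(2) by blast
  next
    case False
    then have "H a a1" using step(1) by auto
    then show ?thesis using step(3) H_M[of a a1]
      by (meson converse_rtranclp_into_rtranclp r_into_rtranclp)
  qed
qed auto

text \<open>Once an \<open>M\<close> step has occurred, every later \<open>H\<close> step merges
  into the \<open>M\<close> step before it, so the path becomes an \<open>M\<close> chain that
  termination can refute when it closes a cycle.\<close>

lemma M_reach_tranclp:
  assumes "reach b c" "M a b"
  shows "M\<^sup>+\<^sup>+ a c"
  using assms(1)
proof (induction rule: rtranclp_induct)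
  case base
  then show ?case using assms(2) by blast
next
  case (step c d)
  show ?case
  proof (cases "P c d")
    case True
    then show ?thesis using P_mod step(3) by (meson tranclp.trancl_into_trancl)
  next
    case False
    then have H: "H\<^sup>*\<^sup>* c d" using step(2) by auto
    \<comment> \<open>The last \<open>M\<close> step of the chain is split off so that it can absorb
      the trailing \<open>H\<close> step.\<close>
    from step(3) obtain e where "M\<^sup>*\<^sup>* a e" "M e c" 
      by (metis tranclp_into_rtranclp tranclp.cases rtranclp.rtrancl_refl)
    then show ?thesis using M_H[OF _ H, of e] by (metis rtranclp_into_tranclp1)
  qed
qed

lemma M_not_reach_back:
  assumes "M a b" shows "\<not> reach b a"
proof
  assume "reach b a"
  then have "M\<^sup>+\<^sup>+ a a" using M_reach_tranclp assms by blast
  then have "(M\<inverse>\<inverse>)\<^sup>+\<^sup>+ a a" by (simp add: tranclp_converse)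
  moreover have "wfp (M\<inverse>\<inverse>)\<^sup>+\<^sup>+" using wfp_mod by (rule wfp_tranclp)
  ultimately show False by (metis wfp_imp_irreflp irreflpD)
qed

text \<open>If \<open>c\<close> took no step in the join, then \<open>b\<close> would lead back to \<open>a\<close>, against termination.\<close>

lemma coherence_step:
  assumes "P a b" "H a c"
  shows "\<exists>d e. P c d \<and> reach b e \<and> reach d e"
proof -
  obtain u v where uv: "P\<^sup>*\<^sup>* b u" "P\<^sup>*\<^sup>* c v" "H\<^sup>*\<^sup>* u v"
    using local_coherence[OF assms] by blast
  have bv: "reach b v" using P_reach[OF uv(1)] H_reach[OF uv(3)] by (rule rtranclp_trans)
  from uv(2) show ?thesis
  proof (cases rule: converse_rtranclpE)
    case base
    have "reach v a" using assms(2) base H_reach H_rtranclp_sym by blast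
    then have "reach b a" using bv by (meson rtranclp_trans)
    then show ?thesis using M_not_reach_back P_mod[OF assms(1)] by blast
  next
    case (step d)
    then show ?thesis using bv P_reach by blast
  qed
qed

text \<open>Well-founded induction along \<open>M\<close>. Since \<open>M\<close> absorbs
  \<open>H\<close>, the hypothesis covers every step leaving the \<open>H\<close>-class of
  \<open>a\<close>; local peaks are first spread over this class and then closed through normal
  forms of successors.\<close>

lemma reach_nf_unique:
  "reach a b \<Longrightarrow> reach a c \<Longrightarrow> nf b \<Longrightarrow> nf c \<Longrightarrow> H\<^sup>*\<^sup>* b c"
proof (induction a arbitrary: b c rule: wfp_induct_rule[OF wfp_mod])
  case (1 a)
  have IH: "H\<^sup>*\<^sup>* b c" if "M a a'" "reach a' b" "reach a' c" "nf b" "nf c" for a' b c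
    using 1(1)[of a' b c] that by blast
  \<comment> \<open>Chains two joins that share the \<open>M\<close>-successor \<open>y\<close>:
    normal forms of \<open>d\<close> and \<open>e\<close> are both reachable from \<open>y\<close>,
    hence equivalent by induction.\<close>
  have meet: "\<exists>f. reach x f \<and> reach z f"
    if "M a y" "reach x d" "reach y d" "reach y e" "reach z e" for x y z d e
  proof -
    obtain m n where mn: "P\<^sup>*\<^sup>* d m" "nf m" "P\<^sup>*\<^sup>* e n" "nf n" using ex_nf by metis
    have "H\<^sup>*\<^sup>* m n"
      using IH[of y m n] that mn P_reach by (meson rtranclp_trans)
    then have "reach x n" using that(2) mn(1) P_reach H_reach by (meson rtranclp_trans)
    moreover have "reach z n" using that(5) mn(3) P_reach by (meson rtranclp_trans)
    ultimately show ?thesis by blast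
  qed
  \<comment> \<open>The \<open>P\<close> step crosses a chain of equations one use at a time. Each
    intermediate target \<open>d\<close> is an \<open>M\<close>-successor of \<open>a\<close>, so
    \<open>meet\<close> glues consecutive joins.\<close>
  have coherent: "\<exists>d e. P y d \<and> reach b e \<and> reach d e"
    if "H\<^sup>*\<^sup>* x y" "H\<^sup>*\<^sup>* a x" "P x b" for x y b
    using that(1)
  proof (induction rule: rtranclp_induct)
    case base
    then show ?case using that by blast
  next
    case (step y z)
    obtain d e where de: "P y d" "reach b e" "reach d e" using step by blast
    obtain d' e' where de': "P z d'" "reach d e'" "reach d' e'"
      using coherence_step[OF de(1) step(2)] by blast
    have "M a d" using that(2) step(1) P_mod[OF de(1)] by (meson H_M)
    from meet[OF this de(2,3) de'(2,3)] show ?case using de'(1) by blast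
  qed
  \<comment> \<open>The two \<open>R\<close> steps start at different members of the class of
    \<open>a\<close>. The first is moved, as a \<open>P\<close> step, to the source \<open>y\<close>
    of the second, where local confluence applies.\<close>
  have peak: "\<exists>e. reach b e \<and> reach c e" if Mb: "M a b" and Mc: "M a c" for b c
  proof -
    obtain x b1 where x: "H\<^sup>*\<^sup>* a x" "R x b1" "H\<^sup>*\<^sup>* b1 b" using Mb by blast
    obtain y c1 where y: "H\<^sup>*\<^sup>* a y" "R y c1" "H\<^sup>*\<^sup>* c1 c" using Mc by blast
    have "H\<^sup>*\<^sup>* x y" using x(1) y(1) H_rtranclp_sym by (meson rtranclp_trans)
    from coherent[OF this x(1) R_P[OF x(2)]]
    obtain d e where de: "P y d" "reach b1 e" "reach d e" by blast
    obtain u v where uv: "P\<^sup>*\<^sup>* d u" "P\<^sup>*\<^sup>* c1 v" "H\<^sup>*\<^sup>* u v"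
      using local_confluence[OF de(1) y(2)] by blast
    have "M a d" using H_M[OF y(1) P_mod[OF de(1)]] .
    moreover have "reach d v" using uv P_reach H_reach by (meson rtranclp_trans)
    ultimately obtain f where "reach b1 f" "reach c1 f"
      using meet[of d b1 e v c1] de uv(2) P_reach by blast
    moreover have "reach b b1" "reach c c1"
      using x(3) y(3) H_reach H_rtranclp_sym by blast+
    ultimately show ?thesis by (meson rtranclp_trans)
  qed
  \<comment> \<open>Coherence would carry the step over to the equivalent normal form
    \<open>b\<close>, which has none.\<close>
  have no_M: False if ab: "H\<^sup>*\<^sup>* a b" "nf b" and Ma: "M a a'" for a' b
  proof -
    obtain x b1 where x: "H\<^sup>*\<^sup>* a x" "R x b1" using Ma by blast
    have "H\<^sup>*\<^sup>* x b" using x(1) ab(1) H_rtranclp_sym by (meson rtranclp_trans)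
    then show False using coherent[OF _ x(1) R_P[OF x(2)]] ab(2) by (auto simp: nf_def)
  qed
  \<comment> \<open>The mixed cases are excluded by \<open>no_M\<close>.\<close>
  consider "H\<^sup>*\<^sup>* a b" "H\<^sup>*\<^sup>* a c" | b' c' where "M a b'" "reach b' b" "M a c'" "reach c' c"
    using reach_cases[OF 1(2)] reach_cases[OF 1(3)] no_M 1(4,5) by metis
  then show ?case
  proof cases
    case 1
    then show ?thesis using H_rtranclp_sym by (meson rtranclp_trans)
  next
    case 2
    obtain e where e: "reach b' e" "reach c' e" using peak[OF 2(1,3)] by blast
    obtain n where n: "P\<^sup>*\<^sup>* e n" "nf n" using ex_nf by blast
    have "reach b' n" "reach c' n" using e P_reach[OF n(1)] by (meson rtranclp_trans)+
    \<comment> \<open>The normal form \<open>n\<close> is the bridge: induction at \<open>b'\<close>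
      relates it to \<open>b\<close>, induction at \<open>c'\<close> to \<open>c\<close>.\<close>
    then have "H\<^sup>*\<^sup>* b n" "H\<^sup>*\<^sup>* n c" using IH 2 1(4,5) n(2) by blast+
    then show ?thesis by (rule rtranclp_trans)
  qed
qed

lemma reach_joinable:
  assumes "reach a b" "reach a c"
  shows "\<exists>u v. P\<^sup>*\<^sup>* b u \<and> P\<^sup>*\<^sup>* c v \<and> H\<^sup>*\<^sup>* u v"
proof -
  obtain m n where "P\<^sup>*\<^sup>* b m" "nf m" "P\<^sup>*\<^sup>* c n" "nf n" using ex_nf by metis
  then show ?thesis using reach_nf_unique[of a m n] assms P_reach by (meson rtranclp_trans)
qed

end

section \<open>Positions, substitutions and renamings\<close>

lemma active_poss_Nil [simp]: "[] \<in> active_poss \<mu> t"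
  by (cases t) auto

lemma active_poss_append:
  "p \<in> active_poss \<mu> t \<Longrightarrow> q \<in> active_poss \<mu> (subt_at t p) \<Longrightarrow> p @ q \<in> active_poss \<mu> t"
  by (induction t p rule: subt_at.induct) auto

lemma replace_at_append:
  "p \<in> active_poss \<mu> t \<Longrightarrow>
    replace_at t (p @ q) u = replace_at t p (replace_at (subt_at t p) q u)"
  by (induction t p rule: subt_at.induct) auto

lemma subt_at_append:
  "p \<in> active_poss \<mu> t \<Longrightarrow> subt_at t (p @ q) = subt_at (subt_at t p) q"
  by (induction t p rule: subt_at.induct) auto

lemma active_poss_replace_at: "p \<in> active_poss \<mu> t \<Longrightarrow> p \<in> active_poss \<mu> (replace_at t p u)"
  by (induction t p rule: subt_at.induct) auto

lemma subt_at_replace_at: "p \<in> active_poss \<mu> t \<Longrightarrow> subt_at (replace_at t p u) p = u"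
  by (induction t p rule: subt_at.induct) auto

lemma replace_at_replace_at:
  "p \<in> active_poss \<mu> t \<Longrightarrow> replace_at (replace_at t p u) p v = replace_at t p v"
  by (induction t p rule: subt_at.induct) auto

lemma active_poss_subst: "p \<in> active_poss \<mu> t \<Longrightarrow> p \<in> active_poss \<mu> (subst \<sigma> t)"
  by (induction t p rule: subt_at.induct) auto

lemma subt_at_subst:
  "p \<in> active_poss \<mu> t \<Longrightarrow> subt_at (subst \<sigma> t) p = subst \<sigma> (subt_at t p)"
  by (induction t p rule: subt_at.induct) auto

lemma replace_at_subst:
  "p \<in> active_poss \<mu> t \<Longrightarrow> replace_at (subst \<sigma> t) p (subst \<sigma> u) = subst \<sigma> (replace_at t p u)"
  by (induction t p rule: subt_at.induct) (auto simp: map_update)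

text \<open>Origin of the distinction between critical pairs and variable pairs: a step in an
  instance happens either within the pattern or within the value of a variable at an active
  position.\<close>

lemma active_poss_subst_cases:
  assumes "p \<in> active_poss \<mu> (subst \<sigma> t)"
  obtains (overlap) "p \<in> active_poss \<mu> t" "\<nexists>x. subt_at t p = Var x"
  | (variable) x p1 p2 where "p = p1 @ p2" "p1 \<in> active_poss \<mu> t" "subt_at t p1 = Var x"
      "p2 \<in> active_poss \<mu> (\<sigma> x)"
proof -
  have "(p \<in> active_poss \<mu> t \<and> (\<nexists>x. subt_at t p = Var x)) \<or>
    (\<exists>x p1 p2. p = p1 @ p2 \<and> p1 \<in> active_poss \<mu> t \<and> subt_at t p1 = Var x \<and>
      p2 \<in> active_poss \<mu> (\<sigma> x))"
    using assms
  proof (induction t arbitrary: p)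
    case (Var x)
    then show ?case by auto
  next
    case (Fun f ts)
    show ?case
    proof (cases p)
      case Nil
      then show ?thesis by auto
    next
      case (Cons i q)
      then have i: "i < length ts" "i \<in> \<mu> f" "q \<in> active_poss \<mu> (subst \<sigma> (ts ! i))"
        using Fun.prems by auto
      from Fun.IH[OF nth_mem[OF i(1)] i(3)] show ?thesis
      proof (elim disjE exE conjE)
        fix x p1 p2
        assume "q = p1 @ p2" "p1 \<in> active_poss \<mu> (ts ! i)" "subt_at (ts ! i) p1 = Var x"
          "p2 \<in> active_poss \<mu> (\<sigma> x)"
        then show ?thesis using i Cons
          by (intro disjI2 exI[of _ x] exI[of _ "i # p1"] exI[of _ p2]) auto
      qed (use i Cons in auto)
    qed
  qed
  then show thesis using that by blast
qed

section \<open>Composition of substitutions and renaming apart\<close>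

lemma subst_subst: "subst \<sigma> (subst \<tau> t) = subst (\<lambda>x. subst \<sigma> (\<tau> x)) t"
  by (induction t) auto

lemma subst_atom_subst_atom:
  "subst_atom \<sigma> (subst_atom \<tau> A) = subst_atom (\<lambda>x. subst \<sigma> (\<tau> x)) A"
  by (cases A) (auto simp: subst_subst)

lemma subst_cong: "(\<And>x. x \<in> vars t \<Longrightarrow> \<sigma> x = \<tau> x) \<Longrightarrow> subst \<sigma> t = subst \<tau> t"
  by (induction t) auto

lemma subst_atom_cong:
  "(\<And>x. x \<in> atom_vars A \<Longrightarrow> \<sigma> x = \<tau> x) \<Longrightarrow> subst_atom \<sigma> A = subst_atom \<tau> A"
  by (cases A) (auto intro!: subst_cong)

lemma vars_rename: "vars (subst (Var \<circ> \<pi>) t) = \<pi> ` vars t"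
  by (induction t) auto

lemma atom_vars_rename: "atom_vars (subst_atom (Var \<circ> \<pi>) A) = \<pi> ` atom_vars A"
  by (cases A) (auto simp: vars_rename)

lemma rule_vars_rename: "rule_vars (rename_rule \<pi> \<alpha>) = \<pi> ` rule_vars \<alpha>"
  by (cases \<alpha>) (auto simp: rule_vars_def rename_rule_def vars_rename atom_vars_rename)

lemma finite_vars: "finite (vars t)"
  by (induction t) auto

lemma finite_atom_vars: "finite (atom_vars A)"
  by (cases A) (auto simp: finite_vars)

lemma finite_rule_vars: "finite (rule_vars \<alpha>)"
  by (cases \<alpha>) (auto simp: rule_vars_def finite_vars finite_atom_vars)

text \<open>\<open>variants\<close> requires a bijection on all variables. Exchanging
  \<open>B\<close> with an equally large set \<open>C\<close> outside \<open>A\<close> and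
  \<open>B\<close>, and fixing the rest, is an involution and hence bijective.\<close>

lemma ex_bij_disjoint_image:
  fixes A B :: "'a :: infinite set"
  assumes "finite A" "finite B"
  obtains \<pi> where "bij \<pi>" "\<pi> ` B \<inter> A = {}"
proof -
  have "infinite (UNIV - (A \<union> B))" using assms infinite_UNIV by (simp add: Diff_infinite_finite)
  then obtain C where C: "finite C" "card C = card B" "C \<subseteq> UNIV - (A \<union> B)"
    using infinite_arbitrarily_large by metis
  then obtain f where f: "bij_betw f B C"
    using finite_same_card_bij assms(2) by metis
  define \<pi> where
    "\<pi> x = (if x \<in> B then f x else if x \<in> C then inv_into B f x else x)" for x
  have "\<pi> (\<pi> x) = x" for x
  proof -
    consider "x \<in> B" | "x \<in> C" "x \<notin> B" | "x \<notin> B" "x \<notin> C" by blast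
    then show ?thesis
    proof cases
      case 1
      then have "f x \<in> C" using f by (auto simp: bij_betw_def)
      then show ?thesis using 1 C(3) f by (auto simp: \<pi>_def bij_betw_inv_into_left)
    next
      case 2
      then have "inv_into B f x \<in> B" using f by (metis bij_betw_def inv_into_into)
      then show ?thesis using 2 f by (auto simp: \<pi>_def bij_betw_inv_into_right)
    qed (simp add: \<pi>_def)
  qed
  then have "bij \<pi>" by (metis involuntory_imp_bij)
  moreover have "\<pi> ` B \<inter> A = {}" using f C(3) by (auto simp: \<pi>_def bij_betw_def)
  ultimately show thesis by (rule that)
qed

section \<open>Steps of the rewrite relations\<close>

lemma wf_trm_list_update:
  "wf_trm \<R> (Fun f ts) \<Longrightarrow> wf_trm \<R> u \<Longrightarrow> wf_trm \<R> (Fun f (ts[i := u]))"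
  using set_update_subset_insert[of ts i u] by auto

lemma wf_trm_subt_at: "wf_trm \<R> t \<Longrightarrow> p \<in> active_poss \<mu> t \<Longrightarrow> wf_trm \<R> (subt_at t p)"
  by (induction t p rule: subt_at.induct) auto

lemma wf_trm_replace_at:
  "wf_trm \<R> t \<Longrightarrow> p \<in> active_poss \<mu> t \<Longrightarrow> wf_trm \<R> u \<Longrightarrow> wf_trm \<R> (replace_at t p u)"
proof (induction t p u rule: replace_at.induct)
  case (2 f ts i p u)
  then have "wf_trm \<R> (replace_at (ts ! i) p u)" by auto
  then show ?case using wf_trm_list_update[OF 2(2)] by simp
qed auto

text \<open>The set \<open>S\<close> is a parameter so that rules and oriented equations share the
  analysis of root peaks.\<close>

definition redex_inst ::
  "('f, 'p, 'v) egtrs \<Rightarrow> ('f, 'p, 'v) crule set \<Rightarrow> ('f, 'v) trm \<Rightarrow> ('f, 'v) trm \<Rightarrow> bool" where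
  "redex_inst \<R> S s t \<longleftrightarrow> (\<exists>l r c \<sigma>. (l, r, c) \<in> S \<and> wf_subst \<R> \<sigma> \<and> s = subst \<sigma> l \<and>
     (\<forall>A \<in> set c. ded (rm \<R>) (subst_atom \<sigma> A)) \<and> t = subst \<sigma> r)"

abbreviation rule_inst where "rule_inst \<R> \<equiv> redex_inst \<R> (rules (rm \<R>))"

lemma rew_at_iff: "rew_at \<R> p s t \<longleftrightarrow> wf_trm \<R> s \<and> p \<in> active_poss (repl \<R>) s \<and>
  (\<exists>v. rule_inst \<R> (subt_at s p) v \<and> t = replace_at s p v)"
  unfolding rew_at_def redex_inst_def by blast

lemma ps_rew_iff: "ps_rew \<R> s t \<longleftrightarrow> wf_trm \<R> s \<and> (\<exists>p \<in> active_poss (repl \<R>) s.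
  \<exists>u v. E_eq \<R> (subt_at s p) u \<and> rule_inst \<R> u v \<and> t = replace_at s p v)"
  unfolding ps_rew_def redex_inst_def by blast

text \<open>Coherence is checked against one equation use at a time. The context is built
  inductively because equations also apply below inactive arguments, which
  \<open>active_poss\<close> does not reach.\<close>

inductive E_step :: "('f, 'p, 'v) egtrs \<Rightarrow> ('f, 'v) trm \<Rightarrow> ('f, 'v) trm \<Rightarrow> bool" for \<R> where
  root: "redex_inst \<R> (oriented_eqs \<R>) s t \<Longrightarrow> E_step \<R> s t"
| arg: "wf_trm \<R> (Fun f ts) \<Longrightarrow> i < length ts \<Longrightarrow> E_step \<R> (ts ! i) u \<Longrightarrow>
    E_step \<R> (Fun f ts) (Fun f (ts[i := u]))"

definition ps_joinable ::
  "('f, 'p, 'v) egtrs \<Rightarrow> ('f, 'v) trm \<Rightarrow> ('f, 'v) trm \<Rightarrow> bool" where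
  "ps_joinable \<R> s t \<longleftrightarrow> (\<exists>u v. (ps_rew \<R>)\<^sup>*\<^sup>* s u \<and> (ps_rew \<R>)\<^sup>*\<^sup>* t v \<and> E_eq \<R> u v)"

context
  fixes \<R> :: "('f, 'p, 'v) egtrs"
  assumes egtrs: "is_egtrs \<R>"
begin

lemma E_eq_wf: "E_eq \<R> s t \<Longrightarrow> wf_trm \<R> s \<and> wf_trm \<R> t"
  using ded_Eq_wf[OF egtrs] unfolding E_eq_def by blast

lemma E_eq_refl: "wf_trm \<R> s \<Longrightarrow> E_eq \<R> s s"
  by (simp add: E_eq_def ded.eq_refl)

lemma E_eq_sym: "E_eq \<R> s t \<Longrightarrow> E_eq \<R> t s"
  unfolding E_eq_def by (rule ded.eq_sym)

lemma E_eq_trans: "E_eq \<R> s t \<Longrightarrow> E_eq \<R> t u \<Longrightarrow> E_eq \<R> s u"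
  unfolding E_eq_def by (rule ded.eq_trans)

lemma E_eq_cong: "wf_trm \<R> (Fun f ts) \<Longrightarrow> i < length ts \<Longrightarrow> E_eq \<R> (ts ! i) u \<Longrightarrow>
    E_eq \<R> (Fun f ts) (Fun f (ts[i := u]))"
  unfolding E_eq_def by (rule ded.eq_cong) auto

lemma E_eq_replace_at: "wf_trm \<R> t \<Longrightarrow> p \<in> active_poss (repl \<R>) t \<Longrightarrow>
  E_eq \<R> (subt_at t p) u \<Longrightarrow> E_eq \<R> t (replace_at t p u)"
proof (induction t p u rule: replace_at.induct)
  case (2 f ts i p u)
  then show ?case by (auto intro!: E_eq_cong)
qed auto

lemma rules_rm_wf:
  assumes "(l, r, c) \<in> rules (rm \<R>)"
  shows "wf_trm \<R> l" "wf_trm \<R> r"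
proof -
  obtain c0 where c0: "(l, r, c0) \<in> rules \<R>" using assms by (auto simp: rm_def)
  then have "(Step l r, c0) \<in> clauses \<R>" by (simp add: clauses_def)
  then have "wf_atom \<R> (Step l r)" using egtrs unfolding is_egtrs_def by blast
  then show "wf_trm \<R> l" "wf_trm \<R> r" by simp_all
qed

lemma rule_inst_wf: "rule_inst \<R> s t \<Longrightarrow> wf_trm \<R> s \<and> wf_trm \<R> t"
  by (auto simp: redex_inst_def rules_rm_wf wf_trm_subst)

lemma ps_rew_wf: "ps_rew \<R> s t \<Longrightarrow> wf_trm \<R> s \<and> wf_trm \<R> t"
  unfolding ps_rew_iff using rule_inst_wf wf_trm_replace_at by blast

lemma ps_rews_wf: "(ps_rew \<R>)\<^sup>*\<^sup>* s t \<Longrightarrow> wf_trm \<R> s \<Longrightarrow> wf_trm \<R> t"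
  by (induction rule: rtranclp_induct) (auto dest: ps_rew_wf)

lemma rew_wf: "rew \<R> s t \<Longrightarrow> wf_trm \<R> s \<and> wf_trm \<R> t"
  unfolding rew_def rew_at_iff using rule_inst_wf wf_trm_replace_at by blast

lemma rew_ps_rew: "rew \<R> s t \<Longrightarrow> ps_rew \<R> s t"
  unfolding rew_def rew_at_iff ps_rew_iff using E_eq_refl wf_trm_subt_at by blast

text \<open>Exchanging the subterm for the matched instance \<open>u\<close> is an equality in
  context; the rest is a plain step at the same position.\<close>

lemma ps_rew_mod_rew: "ps_rew \<R> s t \<Longrightarrow> mod_rew \<R> s t"
proof -
  assume st: "ps_rew \<R> s t"
  then obtain p u v where *: "wf_trm \<R> s" "p \<in> active_poss (repl \<R>) s"
    "E_eq \<R> (subt_at s p) u" "rule_inst \<R> u v" "t = replace_at s p v"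
    unfolding ps_rew_iff by blast
  let ?s = "replace_at s p u"
  have E: "E_eq \<R> s ?s" using E_eq_replace_at * by blast
  have "rew_at \<R> p ?s t" unfolding rew_at_iff
    using E_eq_wf[OF E] *(2,4,5) by (auto simp: active_poss_replace_at subt_at_replace_at
      replace_at_replace_at intro!: exI[of _ v])
  then show ?thesis
    using E E_eq_refl ps_rew_wf[OF st] unfolding mod_rew_def rew_def by blast
qed

lemma ps_rews_mod_rews: "(ps_rew \<R>)\<^sup>*\<^sup>* s t \<Longrightarrow> (mod_rew \<R>)\<^sup>*\<^sup>* s t"
  by (metis (no_types) ps_rew_mod_rew mono_rtranclp)

section \<open>Closure of steps and joins under active arguments\<close>

lemma ps_rew_arg:
  assumes "ps_rew \<R> s t" "wf_trm \<R> (Fun f ts)" "i < length ts" "i \<in> repl \<R> f"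
  shows "ps_rew \<R> (Fun f (ts[i := s])) (Fun f (ts[i := t]))"
proof -
  obtain p u v where *: "wf_trm \<R> s" "p \<in> active_poss (repl \<R>) s"
    "E_eq \<R> (subt_at s p) u" "rule_inst \<R> u v" "t = replace_at s p v"
    using assms(1) unfolding ps_rew_iff by blast
  have "wf_trm \<R> (Fun f (ts[i := s]))" using wf_trm_list_update[OF assms(2) *(1)] .
  then show ?thesis unfolding ps_rew_iff
    using * assms(3,4) by (intro conjI bexI[of _ "i # p"] exI[of _ u] exI[of _ v]) auto
qed

lemma ps_rews_arg:
  assumes "(ps_rew \<R>)\<^sup>*\<^sup>* s t" "wf_trm \<R> (Fun f ts)" "i < length ts" "i \<in> repl \<R> f"
  shows "(ps_rew \<R>)\<^sup>*\<^sup>* (Fun f (ts[i := s])) (Fun f (ts[i := t]))"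
  using assms(1)
  by (induction rule: rtranclp_induct) (auto intro: rtranclp.rtrancl_into_rtrancl ps_rew_arg assms)

lemma ps_joinable_arg:
  assumes "ps_joinable \<R> s t" "wf_trm \<R> (Fun f ts)" "i < length ts" "i \<in> repl \<R> f"
  shows "ps_joinable \<R> (Fun f (ts[i := s])) (Fun f (ts[i := t]))"
proof -
  obtain u v where uv: "(ps_rew \<R>)\<^sup>*\<^sup>* s u" "(ps_rew \<R>)\<^sup>*\<^sup>* t v" "E_eq \<R> u v"
    using assms(1) unfolding ps_joinable_def by blast
  have "wf_trm \<R> (Fun f (ts[i := u]))" using wf_trm_list_update[OF assms(2)] E_eq_wf[OF uv(3)] by blast
  from E_eq_cong[OF this, of i v] have "E_eq \<R> (Fun f (ts[i := u])) (Fun f (ts[i := v]))"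
    using uv(3) assms(3) by simp
  then show ?thesis unfolding ps_joinable_def
    using ps_rews_arg[OF uv(1) assms(2-)] ps_rews_arg[OF uv(2) assms(2-)] by blast
qed

section \<open>E-equality as chains of single equation uses\<close>

lemma E_step_E_eq: "E_step \<R> s t \<Longrightarrow> E_eq \<R> s t"
proof (induction rule: E_step.induct)
  case (root s t)
  then obtain l r c \<sigma> where *: "(l, r, c) \<in> oriented_eqs \<R>" "wf_subst \<R> \<sigma>" "s = subst \<sigma> l"
    "\<forall>A \<in> set c. ded (rm \<R>) (subst_atom \<sigma> A)" "t = subst \<sigma> r"
    unfolding redex_inst_def by blast
  have "E_eq \<R> (subst \<sigma> l') (subst \<sigma> r')" if "(l', r', c) \<in> eqs \<R>" for l' r'
    unfolding E_eq_def using that * by (intro ded.eq_clause[of _ _ c]) auto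
  with * E_eq_sym show ?case by (auto simp: oriented_eqs_def)
qed (rule E_eq_cong)

text \<open>Well-formedness is assumed because the empty chain relates even an ill-formed term to
  itself, while \<open>E_eq\<close> holds between well-formed terms only.\<close>

lemma E_steps_wf_E_eq: "(E_step \<R>)\<^sup>*\<^sup>* s t \<Longrightarrow> wf_trm \<R> s \<Longrightarrow> E_eq \<R> s t"
  by (induction rule: rtranclp_induct) (auto intro: E_eq_refl E_eq_trans E_step_E_eq)

lemma symp_E_step: "symp (E_step \<R>)"
proof
  fix s t
  assume "E_step \<R> s t"
  then show "E_step \<R> t s"
  proof (induction rule: E_step.induct)
    case (root s t)
    have "(r, l, c) \<in> oriented_eqs \<R>" if "(l, r, c) \<in> oriented_eqs \<R>" for l r c
      using that by (auto simp: oriented_eqs_def)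
    then show ?case using root unfolding redex_inst_def
      by (intro E_step.root) (unfold redex_inst_def, blast)
  next
    case (arg f ts i u)
    have "wf_trm \<R> (Fun f (ts[i := u]))"
      using wf_trm_list_update[OF arg(1)] E_eq_wf[OF E_step_E_eq[OF arg(3)]] by blast
    from E_step.arg[OF this, of i "ts ! i"] show ?case using arg by simp
  qed
qed

lemma E_steps_arg:
  assumes "(E_step \<R>)\<^sup>*\<^sup>* s t" "wf_trm \<R> (Fun f ts)" "i < length ts" "s = ts ! i"
  shows "(E_step \<R>)\<^sup>*\<^sup>* (Fun f ts) (Fun f (ts[i := t]))"
  using assms(1)
proof (induction rule: rtranclp_induct)
  case base
  then show ?case using assms by simp
next
  case (step t u)
  have "wf_trm \<R> (Fun f (ts[i := t]))"
    using wf_trm_list_update[OF assms(2)] E_eq_wf[OF E_step_E_eq[OF step(2)]] by blast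
  from E_step.arg[OF this, of i u] step assms(3) show ?case
    by (auto intro: rtranclp.rtrancl_into_rtrancl)
qed

text \<open>A derivation of an equality is flattened into a chain: symmetry reverses chains,
  congruence lifts them, and Horn clauses never conclude an equality.\<close>

lemma E_eq_E_steps: "E_eq \<R> s t \<Longrightarrow> (E_step \<R>)\<^sup>*\<^sup>* s t"
proof -
  have "A = Eq s t \<Longrightarrow> (E_step \<R>)\<^sup>*\<^sup>* s t" if "ded (rm \<R>) A" for A s t
    using that
  proof (induction arbitrary: s t rule: ded.induct)
    case (eq_sym s t)
    then show ?case by (metis atom.inject(1) symp_E_step sympD symp_rtranclp)
  next
    case (eq_trans s t u)
    then show ?case by (metis atom.inject(1) rtranclp_trans)
  next
    case (eq_cong f ts i u)
    then show ?case by (auto intro!: E_steps_arg)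
  next
    case (eq_clause l r c \<sigma>)
    then have "redex_inst \<R> (oriented_eqs \<R>) (subst \<sigma> l) (subst \<sigma> r)"
      unfolding redex_inst_def oriented_eqs_def
      by (intro exI[of _ l] exI[of _ r] exI[of _ c] exI[of _ \<sigma>]) auto
    then show ?case using eq_clause.prems by (auto intro: E_step.root)
  next
    case (horn_clause B c \<sigma>)
    then obtain P ts where "B = Pred P ts"
      using is_egtrs_horn_head[OF egtrs] by blast
    then show ?case using horn_clause.prems by simp
  qed auto
  then show "E_eq \<R> s t \<Longrightarrow> (E_step \<R>)\<^sup>*\<^sup>* s t" unfolding E_eq_def by blast
qed

text \<open>Identifies rewriting modulo \<open>E\<close> with the relation \<open>M\<close> of the
  abstract setting.\<close>

lemma mod_rew_eq_E_steps: "mod_rew \<R> = (E_step \<R>)\<^sup>*\<^sup>* OO rew \<R> OO (E_step \<R>)\<^sup>*\<^sup>*"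
proof (intro ext iffI)
  fix s t
  assume "mod_rew \<R> s t"
  then show "((E_step \<R>)\<^sup>*\<^sup>* OO rew \<R> OO (E_step \<R>)\<^sup>*\<^sup>*) s t"
    unfolding mod_rew_def using E_eq_E_steps by blast
next
  fix s t
  assume "((E_step \<R>)\<^sup>*\<^sup>* OO rew \<R> OO (E_step \<R>)\<^sup>*\<^sup>*) s t"
  then obtain u v where "(E_step \<R>)\<^sup>*\<^sup>* s u" "rew \<R> u v" "(E_step \<R>)\<^sup>*\<^sup>* v t" by blast
  \<comment> \<open>\<open>rew_wf\<close> gives well-formedness of \<open>u\<close>, not yet of
    \<open>s\<close>; the chain is therefore reversed so that it starts at \<open>u\<close>.\<close>
  moreover from this have "(E_step \<R>)\<^sup>*\<^sup>* u s" by (metis symp_E_step sympD symp_rtranclp)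
  ultimately show "mod_rew \<R> s t" unfolding mod_rew_def
    using E_steps_wf_E_eq rew_wf E_eq_sym by blast
qed

end

section \<open>Joinability of local peaks\<close>

context
  fixes \<R> :: "('f, 'p, 'v :: infinite) egtrs"
  assumes egtrs: "is_egtrs \<R>"
begin

section \<open>Peaks with one step at the root\<close>

text \<open>The Peterson-Stickel match is exactly a solution of the pair's condition
  \<open>subt_at l p = l'\<close>, because that condition is itself evaluated modulo
  \<open>E\<close>.\<close>

lemma overlap_joinable:
  assumes LCCPs: "\<forall>\<pi> \<in> LCCPs \<R> S (rules (rm \<R>)). joinable_mod \<R> (ps_rew \<R>) \<pi>"
    and \<alpha>: "(l, r, c) \<in> S" "wf_subst \<R> \<sigma>" "\<forall>A \<in> set c. ded (rm \<R>) (subst_atom \<sigma> A)"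
    and p: "p \<in> active_poss (repl \<R>) l" "\<nexists>x. subt_at l p = Var x"
    and uv: "E_eq \<R> (subst \<sigma> (subt_at l p)) u" "rule_inst \<R> u v"
  shows "ps_joinable \<R> (replace_at (subst \<sigma> l) p v) (subst \<sigma> r)"
proof -
  obtain l' r' c' \<tau> where \<beta>: "(l', r', c') \<in> rules (rm \<R>)" "wf_subst \<R> \<tau>" "u = subst \<tau> l'"
    "\<forall>A \<in> set c'. ded (rm \<R>) (subst_atom \<tau> A)" "v = subst \<tau> r'"
    using uv(2) unfolding redex_inst_def by blast
  obtain \<pi> where \<pi>: "bij \<pi>" "\<pi> ` rule_vars (l', r', c') \<inter> rule_vars (l, r, c) = {}"
    using ex_bij_disjoint_image finite_rule_vars by metis
  \<comment> \<open>One solution of the pair: \<sigma> on the outer rule, and \<tau> after undoing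
    the renaming everywhere else, in particular on the inner rule.\<close>
  define \<rho> where "\<rho> x = (if x \<in> rule_vars (l, r, c) then \<sigma> x else \<tau> (inv \<pi> x))" for x
  have \<rho>_\<pi>: "\<rho> (\<pi> x) = \<tau> x" if "x \<in> rule_vars (l', r', c')" for x
    using that \<pi> by (auto simp: \<rho>_def bij_is_inj)
  have wf\<rho>: "wf_subst \<R> \<rho>" using \<alpha>(2) \<beta>(2) by (auto simp: wf_subst_def \<rho>_def)
  have left: "subst \<rho> l = subst \<sigma> l" "subst \<rho> r = subst \<sigma> r"
    "\<And>A. A \<in> set c \<Longrightarrow> subst_atom \<rho> A = subst_atom \<sigma> A"
    by (auto intro!: subst_cong subst_atom_cong simp: \<rho>_def rule_vars_def)
  have right: "subst \<rho> (subst (Var \<circ> \<pi>) l') = subst \<tau> l'" "subst \<rho> (subst (Var \<circ> \<pi>) r') = subst \<tau> r'"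
    "\<And>A. A \<in> set c' \<Longrightarrow> subst_atom \<rho> (subst_atom (Var \<circ> \<pi>) A) = subst_atom \<tau> A"
    unfolding subst_subst subst_atom_subst_atom
    by (auto intro!: subst_cong subst_atom_cong \<rho>_\<pi> simp: rule_vars_def)
  have sub: "subst \<rho> (subt_at l p) = subst \<sigma> (subt_at l p)"
    using left(1) subt_at_subst[OF p(1)] by metis
  let ?l = "subst (Var \<circ> \<pi>) l'" and ?r = "subst (Var \<circ> \<pi>) r'"
    and ?c = "map (subst_atom (Var \<circ> \<pi>)) c'"
  let ?cond = "Base (Eq (subt_at l p) ?l) # map Base c @ map Base ?c"
  have sat: "satisfies \<R> \<rho> ?cond"
    using wf\<rho> \<alpha>(3) \<beta>(3,4) left right uv(1) sub
    by (simp add: satisfies_def E_eq_def ball_Un)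
  have ren: "(?l, ?r, ?c) = rename_rule \<pi> (l', r', c')" by (simp add: rename_rule_def)
  have "(replace_at l p ?r, r, ?cond) \<in> LCCPs \<R> S (rules (rm \<R>))"
    unfolding LCCPs_def mem_Collect_eq
  proof (intro conjI exI)
    show "feasible \<R> (replace_at l p ?r, r, ?cond)" using sat by (auto simp: feasible_def)
    show "(?l, ?r, ?c) \<in> variants (rules (rm \<R>))"
      using \<pi>(1) \<beta>(1) unfolding variants_def ren by blast
    show "rule_vars (l, r, c) \<inter> rule_vars (?l, ?r, ?c) = {}"
      unfolding ren rule_vars_rename using \<pi>(2) by blast
  qed (use \<alpha> p in auto)
  then have "ps_joinable \<R> (subst \<rho> (replace_at l p ?r)) (subst \<rho> r)"
    using LCCPs sat unfolding joinable_mod_def ps_joinable_def by blast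
  moreover have "subst \<rho> (replace_at l p ?r) = replace_at (subst \<sigma> l) p v"
    using replace_at_subst[OF p(1), of \<rho> ?r] left(1) right(2) \<beta>(5) by simp
  ultimately show ?thesis using left(2) by simp
qed

lemma variable_overlap_joinable:
  assumes CVPs: "\<forall>\<pi> \<in> CVPs \<R> S. joinable_mod \<R> (ps_rew \<R>) \<pi>"
    and \<alpha>: "(l, r, c) \<in> S" "wf_subst \<R> \<sigma>" "\<forall>A \<in> set c. ded (rm \<R>) (subst_atom \<sigma> A)"
    and p: "p \<in> active_poss (repl \<R>) l" "subt_at l p = Var x"
    and t: "ps_rew \<R> (\<sigma> x) t"
  shows "ps_joinable \<R> (replace_at (subst \<sigma> l) p t) (subst \<sigma> r)"
proof -
  obtain x' where x': "x' \<notin> rule_vars (l, r, c)"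
    using finite_rule_vars infinite_UNIV ex_new_if_finite by metis
  \<comment> \<open>The fresh variable receives the result of the step below
    \<open>x\<close>.\<close>
  define \<rho> where "\<rho> = \<sigma>(x' := t)"
  have left: "subst \<rho> l = subst \<sigma> l" "subst \<rho> r = subst \<sigma> r"
    "\<And>A. A \<in> set c \<Longrightarrow> subst_atom \<rho> A = subst_atom \<sigma> A"
    using x' by (auto intro!: subst_cong subst_atom_cong simp: \<rho>_def rule_vars_def)
  \<comment> \<open>\<open>x\<close> occurs in \<open>l\<close>, where both substitutions agree;
    comparing the subterms at \<open>p\<close> gives the claim.\<close>
  have "subst \<rho> (Var x) = subst \<sigma> (Var x)"
    using left(1) subt_at_subst[OF p(1)] p(2) by metis
  then have \<rho>: "\<rho> x = \<sigma> x" "\<rho> x' = t" by (auto simp: \<rho>_def)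
  have "wf_subst \<R> \<rho>" using \<alpha>(2) ps_rew_wf[OF egtrs t] by (auto simp: wf_subst_def \<rho>_def)
  then have sat: "satisfies \<R> \<rho> (PSStep (Var x) (Var x') # map Base c)"
    using \<alpha>(3) left t \<rho> by (auto simp: satisfies_def)
  have "(replace_at l p (Var x'), r, PSStep (Var x) (Var x') # map Base c) \<in> CVPs \<R> S"
    unfolding CVPs_def feasible_def mem_Collect_eq prod.case using sat \<alpha>(1) p x' by blast
  then have "ps_joinable \<R> (subst \<rho> (replace_at l p (Var x'))) (subst \<rho> r)"
    using CVPs sat unfolding joinable_mod_def ps_joinable_def by blast
  moreover have "subst \<rho> (replace_at l p (Var x')) = replace_at (subst \<sigma> l) p t"
    using replace_at_subst[OF p(1), of \<rho> "Var x'"] left(1) \<rho> by simp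
  ultimately show ?thesis using left(2) by simp
qed

text \<open>The position of the Peterson-Stickel step in \<open>subst \<sigma> l\<close> decides
  between the two kinds of pairs. With \<open>S\<close> the rules this serves local confluence, with
  \<open>S\<close> the oriented equations local coherence.\<close>

lemma root_peak_joinable:
  assumes "\<forall>\<pi> \<in> LCCPs \<R> S (rules (rm \<R>)) \<union> CVPs \<R> S. joinable_mod \<R> (ps_rew \<R>) \<pi>"
    and "redex_inst \<R> S s s'" "ps_rew \<R> s t"
  shows "ps_joinable \<R> t s'"
proof -
  obtain l r c \<sigma> where \<alpha>: "(l, r, c) \<in> S" "wf_subst \<R> \<sigma>" "s = subst \<sigma> l"
    "\<forall>A \<in> set c. ded (rm \<R>) (subst_atom \<sigma> A)" "s' = subst \<sigma> r"
    using assms(2) unfolding redex_inst_def by blast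
  obtain p u v where *: "wf_trm \<R> s" "p \<in> active_poss (repl \<R>) (subst \<sigma> l)"
    "E_eq \<R> (subt_at s p) u" "rule_inst \<R> u v" "t = replace_at s p v"
    using assms(3) \<alpha>(3) unfolding ps_rew_iff by blast
  from *(2) show ?thesis
  proof (cases rule: active_poss_subst_cases)
    case overlap
    have "E_eq \<R> (subst \<sigma> (subt_at l p)) u"
      using *(3) \<alpha>(3) subt_at_subst[OF overlap(1)] by metis
    from overlap_joinable[OF _ \<alpha>(1,2,4) overlap this *(4)] show ?thesis
      using assms(1) \<alpha> * by blast
  next
    case (variable x p1 p2)
    \<comment> \<open>Below the variable, the part \<open>p2\<close> of the position makes the step
      a Peterson-Stickel step of \<sigma>\<open>x\<close> alone.\<close>
    have x: "subt_at s p1 = \<sigma> x" using subt_at_subst[OF variable(2)] variable(3) \<alpha>(3) by simp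
    have p1: "p1 \<in> active_poss (repl \<R>) s" using active_poss_subst variable(2) \<alpha>(3) by blast
    have "ps_rew \<R> (\<sigma> x) (replace_at (\<sigma> x) p2 v)"
      unfolding ps_rew_iff using \<alpha>(2) variable(1,4) *(3,4) x subt_at_append[OF p1]
      by (auto simp: wf_subst_def)
    from variable_overlap_joinable[OF _ \<alpha>(1,2,4) variable(2,3) this]
    have "ps_joinable \<R> (replace_at s p1 (replace_at (\<sigma> x) p2 v)) s'"
      using assms(1) \<alpha> by blast
    then show ?thesis using *(5) variable(1) replace_at_append[OF p1] x by metis
  qed
qed

text \<open>The term \<open>s\<close> is only E-equal to the instance of \<open>l\<close>, so a
  position inside \<open>s\<close> says nothing about \<open>l\<close>. The pair therefore keeps
  \<open>s\<close> and its reduct whole, as the values of two fresh variables.\<close>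

lemma inner_peak_joinable:
  assumes DCP: "\<forall>\<pi> \<in> DCP \<R>. joinable_mod \<R> (ps_rew \<R>) \<pi>"
    and uv: "E_eq \<R> s u" "rule_inst \<R> u v" and t: "inner_rew \<R> s t"
  shows "ps_joinable \<R> v t"
proof -
  obtain l r c \<sigma> where \<alpha>: "(l, r, c) \<in> rules (rm \<R>)" "wf_subst \<R> \<sigma>" "u = subst \<sigma> l"
    "\<forall>A \<in> set c. ded (rm \<R>) (subst_atom \<sigma> A)" "v = subst \<sigma> r"
    using uv(2) unfolding redex_inst_def by blast
  obtain x where x: "x \<notin> rule_vars (l, r, c)"
    using finite_rule_vars infinite_UNIV ex_new_if_finite by metis
  obtain x' where x': "x' \<notin> insert x (rule_vars (l, r, c))"
    using finite_rule_vars infinite_UNIV ex_new_if_finite finite_insert by metis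
  define \<rho> where "\<rho> = \<sigma>(x := s, x' := t)"
  have left: "subst \<rho> l = subst \<sigma> l" "subst \<rho> r = subst \<sigma> r"
    "\<And>A. A \<in> set c \<Longrightarrow> subst_atom \<rho> A = subst_atom \<sigma> A"
    using x x' by (auto intro!: subst_cong subst_atom_cong simp: \<rho>_def rule_vars_def)
  have \<rho>: "\<rho> x = s" "\<rho> x' = t" using x' by (auto simp: \<rho>_def)
  have "rew \<R> s t" using t unfolding inner_rew_def rew_def by blast
  then have "wf_subst \<R> \<rho>" using \<alpha>(2) rew_wf[OF egtrs] by (auto simp: wf_subst_def \<rho>_def)
  then have sat: "satisfies \<R> \<rho> (Base (Eq (Var x) l) # InnerStep (Var x) (Var x') # map Base c)"
    using \<alpha>(3,4) left \<rho> uv(1) t by (auto simp: satisfies_def E_eq_def)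
  have "(r, Var x', Base (Eq (Var x) l) # InnerStep (Var x) (Var x') # map Base c) \<in> DCP \<R>"
    unfolding DCP_def feasible_def mem_Collect_eq prod.case
    using sat \<alpha>(1) x x' by (intro conjI exI[of _ l] exI[of _ r] exI[of _ c]) auto
  then have "ps_joinable \<R> (subst \<rho> r) (subst \<rho> (Var x'))"
    using DCP sat unfolding joinable_mod_def ps_joinable_def by blast
  then show ?thesis using left(2) \<alpha>(5) \<rho>(2) by simp
qed

section \<open>Local peaks at arbitrary positions\<close>

text \<open>Induction on the context of the equation. At the root the pairs apply; below it, the
  equation is absorbed by a redex at the root, treated by induction in the same argument, or
  commutes with a step in another argument.\<close>

lemma ps_rew_E_step_joinable:
  assumes pairs: "\<forall>\<pi> \<in> LCCP_E \<R> \<union> CVP_ps_E \<R>. joinable_mod \<R> (ps_rew \<R>) \<pi>"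
    and "E_step \<R> s s'" "ps_rew \<R> s t"
  shows "ps_joinable \<R> t s'"
  using assms(2,3)
proof (induction arbitrary: t rule: E_step.induct)
  case (root s s')
  then show ?case using root_peak_joinable pairs unfolding LCCP_E_def CVP_ps_E_def by blast
next
  case (arg f ts i w)
  let ?s = "Fun f ts" and ?s' = "Fun f (ts[i := w])"
  have w: "E_eq \<R> (ts ! i) w" using E_step_E_eq[OF egtrs] arg(3) by blast
  have E: "E_eq \<R> ?s ?s'" using E_eq_cong[OF egtrs] w arg(1,2) by blast
  have wf: "wf_trm \<R> ?s'" using E_eq_wf[OF egtrs E] by blast
  obtain p u v where *: "p \<in> active_poss (repl \<R>) ?s" "E_eq \<R> (subt_at ?s p) u"
    "rule_inst \<R> u v" "t = replace_at ?s p v"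
    using arg.prems unfolding ps_rew_iff by blast
  have wft: "wf_trm \<R> t" using ps_rew_wf[OF egtrs] arg.prems by blast
  show ?case
  proof (cases p)
    case Nil
    \<comment> \<open>A root redex matches modulo \<open>E\<close>, so the changed term still
      matches \<open>u\<close> and rewrites to the same \<open>t\<close>.\<close>
    then have "ps_rew \<R> ?s' t" unfolding ps_rew_iff
      using * wf E_eq_trans[OF egtrs E_eq_sym[OF egtrs E]] by (auto intro!: bexI[of _ "[]"])
    then show ?thesis using E_eq_refl[OF egtrs wft] unfolding ps_joinable_def by blast
  next
    case (Cons j q)
    have j: "j < length ts" "j \<in> repl \<R> f" "q \<in> active_poss (repl \<R>) (ts ! j)"
      using *(1) Cons by auto
    let ?v = "replace_at (ts ! j) q v"
    have t: "t = Fun f (ts[j := ?v])" using *(4) Cons by simp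
    have "wf_trm \<R> (ts ! j)" using arg(1) j(1) by simp
    then have step: "ps_rew \<R> (ts ! j) ?v" unfolding ps_rew_iff using * Cons j by auto
    show ?thesis
    proof (cases "i = j")
      case True
      \<comment> \<open>The Peterson-Stickel position passes through argument \<open>j\<close>, so
        this argument is active and the inner join lifts.\<close>
      then show ?thesis using ps_joinable_arg[OF egtrs arg.IH[of ?v] arg(1)] step j t by simp
    next
      case False
      \<comment> \<open>Here \<open>i\<close> may be inactive: only the rewrite step in
        \<open>j\<close> is replayed, while the change in \<open>i\<close> stays an
        equality.\<close>
      have "ps_rew \<R> ?s' (Fun f (ts[i := w, j := ?v]))"
        using ps_rew_arg[OF egtrs step wf, of j] j False
        by (metis length_list_update list_update_id nth_list_update_neq)
      moreover have "E_eq \<R> t (Fun f (ts[j := ?v, i := w]))"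
        using E_eq_cong[OF egtrs wft[unfolded t], of i w] w arg(2) False t by simp
      ultimately show ?thesis unfolding ps_joinable_def
        using False by (auto simp: list_update_swap)
    qed
  qed
qed

text \<open>Three situations: the rewrite step is at the root, only the Peterson-Stickel step is at
  the root (DCP), or both lie in arguments, where they share one or commute.\<close>

lemma ps_rew_rew_joinable:
  assumes pairs: "\<forall>\<pi> \<in> LCCP \<R> \<union> CVP_ps \<R> \<union> DCP \<R>. joinable_mod \<R> (ps_rew \<R>) \<pi>"
    and "ps_rew \<R> s t" "rew \<R> s s'"
  shows "ps_joinable \<R> t s'"
proof -
  obtain p where "rew_at \<R> p s s'" using assms(3) unfolding rew_def by blast
  then show ?thesis using assms(2)
  proof (induction s arbitrary: p t s')
    case (Var x)
    then have "rule_inst \<R> (Var x) s'" by (auto simp: rew_at_iff)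
    then show ?case
      using root_peak_joinable pairs Var unfolding LCCP_def CVP_ps_def by blast
  next
    case (Fun f ts)
    let ?s = "Fun f ts"
    obtain w where w: "wf_trm \<R> ?s" "p \<in> active_poss (repl \<R>) ?s"
      "rule_inst \<R> (subt_at ?s p) w" "s' = replace_at ?s p w"
      using Fun.prems(1) unfolding rew_at_iff by blast
    obtain q u v where *: "q \<in> active_poss (repl \<R>) ?s" "E_eq \<R> (subt_at ?s q) u"
      "rule_inst \<R> u v" "t = replace_at ?s q v"
      using Fun.prems(2) unfolding ps_rew_iff by blast
    consider "p = []" | "p \<noteq> []" "q = []" | i p' j q' where "p = i # p'" "q = j # q'"
      by (meson neq_Nil_conv)
    then show ?case
    proof cases
      case 1
      then have "rule_inst \<R> ?s s'" using w by simp
      then show ?thesis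
        using root_peak_joinable pairs Fun.prems(2) unfolding LCCP_def CVP_ps_def by blast
    next
      case 2
      then have "inner_rew \<R> ?s s'" using Fun.prems(1) unfolding inner_rew_def by blast
      then show ?thesis using inner_peak_joinable[of ?s u v s'] pairs * 2 by auto
    next
      case 3
      have i: "i < length ts" "i \<in> repl \<R> f" "p' \<in> active_poss (repl \<R>) (ts ! i)"
        using w(2) 3 by auto
      have j: "j < length ts" "j \<in> repl \<R> f" "q' \<in> active_poss (repl \<R>) (ts ! j)"
        using *(1) 3 by auto
      let ?w = "replace_at (ts ! i) p' w" and ?v = "replace_at (ts ! j) q' v"
      have eqs: "s' = Fun f (ts[i := ?w])" "t = Fun f (ts[j := ?v])" using w(4) *(4) 3 by auto
      have wf: "wf_trm \<R> (ts ! i)" "wf_trm \<R> (ts ! j)" using w(1) i(1) j(1) by auto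
      have rw: "rew_at \<R> p' (ts ! i) ?w" unfolding rew_at_iff using w(3) 3 i wf by auto
      have ps: "ps_rew \<R> (ts ! j) ?v" unfolding ps_rew_iff using *(2,3) 3 j wf by auto
      show ?thesis
      proof (cases "i = j")
        case True
        then have "ps_joinable \<R> ?v ?w" using Fun.IH[OF nth_mem[OF i(1)] rw] ps by simp
        then show ?thesis using ps_joinable_arg[OF egtrs _ w(1) i(1,2)] eqs True by blast
      next
        case False
        \<comment> \<open>To commute, the plain step is replayed as a Peterson-Stickel step, the
          only kind of step allowed in the join.\<close>
        have pw: "ps_rew \<R> (ts ! i) ?w" using rew_ps_rew[OF egtrs] rw unfolding rew_def by blast
        have wfs: "wf_trm \<R> s'" "wf_trm \<R> t"
          using rew_wf[OF egtrs] ps_rew_wf[OF egtrs] Fun.prems unfolding rew_def by blast+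
        have "ps_rew \<R> s' (Fun f (ts[i := ?w, j := ?v]))"
          using ps_rew_arg[OF egtrs ps wfs(1)[unfolded eqs], of j] j False eqs
          by (metis length_list_update list_update_id nth_list_update_neq)
        moreover have "ps_rew \<R> t (Fun f (ts[j := ?v, i := ?w]))"
          using ps_rew_arg[OF egtrs pw wfs(2)[unfolded eqs], of i] i False eqs
          by (metis length_list_update list_update_id nth_list_update_neq)
        moreover have "E_eq \<R> (Fun f (ts[j := ?v, i := ?w])) (Fun f (ts[i := ?w, j := ?v]))"
          using E_eq_refl[OF egtrs] ps_rew_wf[OF egtrs calculation(1)] False
          by (metis list_update_swap)
        ultimately show ?thesis unfolding ps_joinable_def by blast
      qed
    qed
  qed
qed

section \<open>The two directions of the criterion\<close>

lemma joinable_pairs_E_confluent: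
  assumes terminating: "E_terminating \<R>"
    and pairs: "\<forall>\<pi> \<in> LCCP \<R> \<union> CVP_ps \<R> \<union> DCP \<R> \<union> LCCP_E \<R> \<union> CVP_ps_E \<R>.
      joinable_mod \<R> (ps_rew \<R>) \<pi>"
  shows "E_confluent \<R>"
proof -
  have wfp: "wfp (mod_rew \<R>)\<inverse>\<inverse>"
    using terminating unfolding E_terminating_def wfp_def wf_iff_no_infinite_down_chain by simp
  have steps: "\<exists>u v. (ps_rew \<R>)\<^sup>*\<^sup>* b u \<and> (ps_rew \<R>)\<^sup>*\<^sup>* c v \<and> (E_step \<R>)\<^sup>*\<^sup>* u v"
    if "ps_joinable \<R> b c" for b c
    using that E_eq_E_steps[OF egtrs] unfolding ps_joinable_def by blast
  interpret rewriting_modulo "E_step \<R>" "rew \<R>" "ps_rew \<R>"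
  proof
    show "symp (E_step \<R>)" by (rule symp_E_step[OF egtrs])
    show "ps_rew \<R> a b" if "rew \<R> a b" for a b using rew_ps_rew[OF egtrs that] .
    show "((E_step \<R>)\<^sup>*\<^sup>* OO rew \<R> OO (E_step \<R>)\<^sup>*\<^sup>*) a b" if "ps_rew \<R> a b" for a b
      using ps_rew_mod_rew[OF egtrs that] unfolding mod_rew_eq_E_steps[OF egtrs] .
    show "wfp ((E_step \<R>)\<^sup>*\<^sup>* OO rew \<R> OO (E_step \<R>)\<^sup>*\<^sup>*)\<inverse>\<inverse>"
      using wfp unfolding mod_rew_eq_E_steps[OF egtrs] .
  next
    fix a b c
    assume "ps_rew \<R> a b" "rew \<R> a c"
    then show "\<exists>u v. (ps_rew \<R>)\<^sup>*\<^sup>* b u \<and> (ps_rew \<R>)\<^sup>*\<^sup>* c v \<and> (E_step \<R>)\<^sup>*\<^sup>* u v"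
      using steps ps_rew_rew_joinable pairs by blast
  next
    fix a b c
    assume "ps_rew \<R> a b" "E_step \<R> a c"
    then show "\<exists>u v. (ps_rew \<R>)\<^sup>*\<^sup>* b u \<and> (ps_rew \<R>)\<^sup>*\<^sup>* c v \<and> (E_step \<R>)\<^sup>*\<^sup>* u v"
      using steps ps_rew_E_step_joinable pairs by blast
  qed
  have M_reach: "reach s t" if "mod_rew \<R> s t" for s t
    using that unfolding mod_rew_eq_E_steps[OF egtrs]
    by (elim relcomppE) (meson H_reach P_reach R_P r_into_rtranclp rtranclp_trans)
  \<comment> \<open>Well-formedness is carried along so that the final chain of equation uses can be
    read as an \<open>E_eq\<close>.\<close>
  have reach: "reach s t \<and> wf_trm \<R> t" if "(mod_rew \<R>)\<^sup>*\<^sup>* s t" "wf_trm \<R> s" for s t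
    using that(1)
  proof (induction rule: rtranclp_induct)
    case (step t u)
    have "wf_trm \<R> u" using step(2) E_eq_wf[OF egtrs] unfolding mod_rew_def by blast
    then show ?case using step(3) M_reach[OF step(2)] by (meson rtranclp_trans)
  qed (use that in auto)
  show ?thesis unfolding E_confluent_def
  proof (intro allI impI, elim conjE)
    fix t t1 t2
    assume t: "wf_trm \<R> t" "(mod_rew \<R>)\<^sup>*\<^sup>* t t1" "(mod_rew \<R>)\<^sup>*\<^sup>* t t2"
    obtain u v where uv: "(ps_rew \<R>)\<^sup>*\<^sup>* t1 u" "(ps_rew \<R>)\<^sup>*\<^sup>* t2 v" "(E_step \<R>)\<^sup>*\<^sup>* u v"
      using reach_joinable reach t by meson
    have "wf_trm \<R> u" using ps_rews_wf[OF egtrs uv(1)] reach t by blast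
    then have "E_eq \<R> u v" using E_steps_wf_E_eq[OF egtrs uv(3)] by blast
    then show "\<exists>t1' t2'. (mod_rew \<R>)\<^sup>*\<^sup>* t1 t1' \<and> (mod_rew \<R>)\<^sup>*\<^sup>* t2 t2' \<and> E_eq \<R> t1' t2'"
      using uv ps_rews_mod_rews[OF egtrs] by blast
  qed
qed

text \<open>A solution of the condition makes both sides one-step successors of a single term: the
  instance of \<open>l\<close> for LCCP and CVP, the value of \<open>x\<close> for DCP.\<close>

lemma E_confluent_joinable_pairs:
  assumes conf: "E_confluent \<R>" and \<pi>: "\<pi> \<in> LCCP \<R> \<union> CVP_ps \<R> \<union> DCP \<R>"
  shows "joinable_mod \<R> (mod_rew \<R>) \<pi>"
proof -
  obtain s t c where stc: "\<pi> = (s, t, c)" by (cases \<pi>)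
  have peak: "\<exists>w. mod_rew \<R> w (subst \<sigma> s) \<and> mod_rew \<R> w (subst \<sigma> t)"
    if sat: "satisfies \<R> \<sigma> c" for \<sigma>
  proof -
    have wf\<sigma>: "wf_subst \<R> \<sigma>" using sat by (simp add: satisfies_def)
    have inst: "rule_inst \<R> (subst \<sigma> l) (subst \<sigma> r)"
      if "(l, r, d) \<in> rules (rm \<R>)" "\<forall>A \<in> set d. ded (rm \<R>) (subst_atom \<sigma> A)" for l r d
      unfolding redex_inst_def using that wf\<sigma> by blast
    have root: "mod_rew \<R> w v" if "E_eq \<R> w u" "rule_inst \<R> u v" for u v w
      using that E_eq_wf[OF egtrs] ps_rew_mod_rew[OF egtrs] unfolding ps_rew_iff
      by (metis active_poss_Nil replace_at.simps(1) subt_at.simps(1))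
    from \<pi> consider "\<pi> \<in> LCCP \<R>" | "\<pi> \<in> CVP_ps \<R>" | "\<pi> \<in> DCP \<R>" by blast
    then show ?thesis
    proof cases
      case 1
      then obtain l r d l' r' d' p where *: "(l, r, d) \<in> rules (rm \<R>)"
        "(l', r', d') \<in> variants (rules (rm \<R>))" "p \<in> active_poss (repl \<R>) l"
        "s = replace_at l p r'" "t = r" "c = Base (Eq (subt_at l p) l') # map Base d @ map Base d'"
        unfolding LCCP_def LCCPs_def stc by blast
      obtain \<pi> l0 r0 d0 where v: "(l0, r0, d0) \<in> rules (rm \<R>)" "l' = subst (Var \<circ> \<pi>) l0"
        "r' = subst (Var \<circ> \<pi>) r0" "d' = map (subst_atom (Var \<circ> \<pi>)) d0"
        using *(2) unfolding variants_def rename_rule_def by auto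
      \<comment> \<open>Composing \<sigma> with the renaming turns the instance of the variant into
        an instance of the original rule.\<close>
      have "rule_inst \<R> (subst \<sigma> l') (subst \<sigma> r')"
        unfolding redex_inst_def v(2,3) subst_subst
      proof (intro exI conjI)
        show "wf_subst \<R> (\<lambda>x. subst \<sigma> ((Var \<circ> \<pi>) x))" using wf\<sigma> by (simp add: wf_subst_def)
        show "\<forall>A \<in> set d0. ded (rm \<R>) (subst_atom (\<lambda>x. subst \<sigma> ((Var \<circ> \<pi>) x)) A)"
          unfolding subst_atom_subst_atom[symmetric]
          using sat *(6) v(4) by (simp add: satisfies_def ball_Un comp_def)
      qed (use v(1) in simp_all)
      moreover have "E_eq \<R> (subt_at (subst \<sigma> l) p) (subst \<sigma> l')"
        using sat *(6) by (simp add: satisfies_def E_eq_def subt_at_subst[OF *(3)])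
      moreover have wfl: "wf_trm \<R> (subst \<sigma> l)"
        using wf\<sigma> rules_rm_wf[OF egtrs *(1)] by (simp add: wf_trm_subst)
      ultimately have "ps_rew \<R> (subst \<sigma> l) (subst \<sigma> s)"
        unfolding ps_rew_iff *(4) replace_at_subst[OF *(3), symmetric]
        using active_poss_subst[OF *(3)] by blast
      moreover have "mod_rew \<R> (subst \<sigma> l) (subst \<sigma> t)"
        using root[OF E_eq_refl[OF egtrs wfl] inst[OF *(1)]] sat *(5,6)
        by (simp add: satisfies_def ball_Un)
      ultimately show ?thesis using ps_rew_mod_rew[OF egtrs] by blast
    next
      case 2
      then obtain l r d p x x' where *: "(l, r, d) \<in> rules (rm \<R>)"
        "p \<in> active_poss (repl \<R>) l" "subt_at l p = Var x"
        "s = replace_at l p (Var x')" "t = r" "c = PSStep (Var x) (Var x') # map Base d"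
        unfolding CVP_ps_def CVPs_def stc by blast
      have wfl: "wf_trm \<R> (subst \<sigma> l)"
        using wf\<sigma> rules_rm_wf[OF egtrs *(1)] by (simp add: wf_trm_subst)
      have p: "p \<in> active_poss (repl \<R>) (subst \<sigma> l)" using active_poss_subst[OF *(2)] .
      have sub: "subt_at (subst \<sigma> l) p = \<sigma> x" using subt_at_subst[OF *(2)] *(3) by simp
      obtain q u v where q: "q \<in> active_poss (repl \<R>) (\<sigma> x)" "E_eq \<R> (subt_at (\<sigma> x) q) u"
        "rule_inst \<R> u v" "\<sigma> x' = replace_at (\<sigma> x) q v"
        using sat *(6) by (auto simp: satisfies_def ps_rew_iff)
      \<comment> \<open>The step at \<open>q\<close> in the value of \<open>x\<close> becomes a step
        of the whole instance at \<open>p @ q\<close>.\<close>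
      have "subst \<sigma> s = replace_at (subst \<sigma> l) (p @ q) v"
        using replace_at_subst[OF *(2), of \<sigma> "Var x'"] *(4) q(4) replace_at_append[OF p] sub by simp
      then have "ps_rew \<R> (subst \<sigma> l) (subst \<sigma> s)"
        unfolding ps_rew_iff using wfl active_poss_append[OF p] q subt_at_append[OF p] sub by metis
      moreover have "mod_rew \<R> (subst \<sigma> l) (subst \<sigma> t)"
        using root[OF E_eq_refl[OF egtrs wfl] inst[OF *(1)]] sat *(5,6)
        by (simp add: satisfies_def ball_Un)
      ultimately show ?thesis using ps_rew_mod_rew[OF egtrs] by blast
    next
      case 3
      then obtain l x x' d where *: "(l, s, d) \<in> rules (rm \<R>)" "t = Var x'"
        "c = Base (Eq (Var x) l) # InnerStep (Var x) (Var x') # map Base d"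
        unfolding DCP_def stc by blast
      \<comment> \<open>The equality condition yields a Peterson-Stickel step at the root of
        \<sigma>\<open>x\<close>; the other condition is a rewrite step from the same term.\<close>
      have "E_eq \<R> (\<sigma> x) (subst \<sigma> l)" using sat *(3) by (simp add: satisfies_def E_eq_def)
      then have "mod_rew \<R> (\<sigma> x) (subst \<sigma> s)"
        using root inst[OF *(1)] sat *(3) by (simp add: satisfies_def)
      moreover have "rew \<R> (\<sigma> x) (\<sigma> x')"
        using sat *(3) by (auto simp: satisfies_def inner_rew_def rew_def)
      then have "mod_rew \<R> (\<sigma> x) (subst \<sigma> t)"
        using *(2) rew_ps_rew[OF egtrs] ps_rew_mod_rew[OF egtrs] by auto
      ultimately show ?thesis by blast
    qed
  qed
  have "\<exists>u v. (mod_rew \<R>)\<^sup>*\<^sup>* (subst \<sigma> s) u \<and> (mod_rew \<R>)\<^sup>*\<^sup>* (subst \<sigma> t) v \<and> E_eq \<R> u v"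
    if sat: "satisfies \<R> \<sigma> c" for \<sigma>
  proof -
    obtain w where w: "mod_rew \<R> w (subst \<sigma> s)" "mod_rew \<R> w (subst \<sigma> t)"
      using peak[OF sat] by blast
    then have "wf_trm \<R> w" using E_eq_wf[OF egtrs] unfolding mod_rew_def by blast
    then show ?thesis using conf w unfolding E_confluent_def by blast
  qed
  then show ?thesis unfolding joinable_mod_def stc by blast
qed

end

theorem theorem11p1:
  fixes \<R> :: "('f, 'p, 'v :: {countable, infinite}) egtrs"
  assumes "is_egtrs \<R>"
  shows "(E_terminating \<R> \<and>
          (\<forall>\<pi> \<in> LCCP \<R> \<union> CVP_ps \<R> \<union> DCP \<R> \<union> LCCP_E \<R> \<union> CVP_ps_E \<R>.
             joinable_mod \<R> (ps_rew \<R>) \<pi>) \<longrightarrow> E_confluent \<R>) \<and>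
         ((\<exists>\<pi> \<in> LCCP \<R> \<union> CVP_ps \<R> \<union> DCP \<R>. \<not> joinable_mod \<R> (mod_rew \<R>) \<pi>) \<longrightarrow>
            \<not> E_confluent \<R>)"
  using joinable_pairs_E_confluent[OF assms] E_confluent_joinable_pairs[OF assms] by blast

end
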